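(* Let $(Q_k)_{k\ge 0}$ be the iterates of asynchronous Q-learning with constant step-size $\alpha\in(0,1)$ under i.i.d. sampling (defined in the context), and for $N\ge 1$ let $\tilde Q_N=\frac1N\sum_{i=0}^{N-1}Q_i$. Then, for every integer $N\ge 1$, $$\mathbb E\big[\|\tilde Q_N-Q^*\|_\infty\big]\le\left(\frac{4\gamma d_{\max}+d_{\min}(1-\gamma)}{d_{\min}^{3/2}(1-\gamma)^{5/2}}\,|\mathcal S||\mathcal A|\right)\sqrt{32\alpha+\frac1N\,\frac4\alpha}.$$
   Context: MDP: finite state space $\mathcal S=\{1,\dots,|\mathcal S|\}$, finite action space $\mathcal A=\{1,\dots,|\mathcal A|\}$, transition probabilities $P(s'|s,a)$, deterministic reward function $r(s,a,s')$, discount factor $\gamma\in[0,1)$. The MDP is assumed ergodic (so that a stationary state distribution exists). For a deterministic policy $\pi:\mathcal S\to\mathcal A$, $Q^\pi(s,a)=\mathbb E[\sum_{k\ge0}\gamma^k r(s_k,a_k,s_{k+1})\mid s_0=s,a_0=a,\pi]$. $Q^*=Q^{\pi^*}$, for an optimal deterministic policy $\pi^*$, is the optimal Q-function; it satisfies the Bellman optimality equation $Q^*(s,a)=\sum_{s'}P(s'|s,a)\,(r(s,a,s')+\gamma\max_{u\in\mathcal A}Q^*(s',u))$. Sampling: $p$ is a probability distribution on $\mathcal S$, $\beta(\cdot|s)$ is a behavior policy (a distribution on $\mathcal A$ for each $s$), and $d(s,a)=p(s)\beta(a|s)$. At each step $k=0,1,\dots$, independently of the past, $s_k\sim p$, $a_k\sim\beta(\cdot|s_k)$,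 $s_k'\sim P(\cdot|s_k,a_k)$ and $r_k=r(s_k,a_k,s_k')$. Q-learning: from a (possibly random) initial $Q_0\in\mathbb R^{|\mathcal S||\mathcal A|}$, $Q_{k+1}(s_k,a_k)=Q_k(s_k,a_k)+\alpha\{r_k+\gamma\max_{u\in\mathcal A}Q_k(s_k',u)-Q_k(s_k,a_k)\}$, all other entries of $Q_k$ being unchanged. Standing assumptions: $d(s,a)>0$ for all $(s,a)$; the step-size is a constant $\alpha\in(0,1)$; $\max_{s,a,s'}|r(s,a,s')|\le 1$; $\|Q_0\|_\infty\le1$. Notation: $d_{\max}=\max_{(s,a)}d(s,a)$, $d_{\min}=\min_{(s,a)}d(s,a)$. *)

theory Defs
  imports "HOL-Probability.Probability"
begin

text \<open>
  The states are the elements of a finite type \<open>'s\<close> and the actions those of a finite type \<open>'a\<close>.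
  The law of the next state given the state-action pair \<open>(s, a)\<close> is \<open>P s a\<close>. Q-functions are
  vectors in \<open>real ^ ('s \<times> 'a)\<close>, whose library norm is Euclidean; the maximum norm is
  the library's \<open>infnorm\<close>.
\<close>

text \<open>
  The state-action trajectory of a policy \<open>\<pi>\<close> started in \<open>(s, a)\<close>: the transition kernels
  and the measure on infinite trajectories that they generate by the Ionescu-Tulcea theorem.
  The initial action is free, only later actions follow \<open>\<pi>\<close>.
\<close>

definition traj_kernel ::
  "('s \<Rightarrow> 'a \<Rightarrow> 's pmf) \<Rightarrow> ('s \<Rightarrow> 'a) \<Rightarrow> 's \<Rightarrow> 'a \<Rightarrow> nat \<Rightarrow> (nat \<Rightarrow> 's \<times> 'a) \<Rightarrow> ('s \<times> 'a) measure"
  where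
  "traj_kernel P \<pi> s a i \<omega> = measure_pmf (case i of
      0 \<Rightarrow> return_pmf (s, a)
    | Suc j \<Rightarrow> map_pmf (\<lambda>s'. (s', \<pi> s')) (P (fst (\<omega> j)) (snd (\<omega> j))))"

lemma Ionescu_Tulcea_traj_kernel:
  fixes P :: "'s::finite \<Rightarrow> 'a::finite \<Rightarrow> 's pmf"
  shows "Ionescu_Tulcea (traj_kernel P \<pi> s a) (\<lambda>_. count_space UNIV)"
proof (rule Ionescu_Tulcea.intro)
  fix i :: nat
  let ?M = "\<lambda>_ :: nat. count_space (UNIV :: ('s \<times> 'a) set)"
  show "traj_kernel P \<pi> s a i \<in> measurable (PiM {0..<i} ?M) (subprob_algebra (count_space UNIV))"
  proof (cases i)
    case 0
    have "traj_kernel P \<pi> s a 0 = (\<lambda>_. measure_pmf (return_pmf (s, a)))"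
      by (simp add: traj_kernel_def fun_eq_iff)
    then show ?thesis
      unfolding 0 by (simp add: space_subprob_algebra measure_pmf.subprob_space_axioms)
  next
    case (Suc j)
    have comp: "(\<lambda>\<omega>. \<omega> j) \<in> measurable (PiM {0..<i} ?M) (count_space UNIV)"
      using Suc by (intro measurable_component_singleton) simp
    have "(\<lambda>x. measure_pmf (map_pmf (\<lambda>s'. (s', \<pi> s')) (P (fst x) (snd x))))
        \<in> measurable (count_space UNIV) (subprob_algebra (count_space UNIV))"
      by (simp add: space_subprob_algebra measure_pmf.subprob_space_axioms)
    from measurable_compose[OF comp this] show ?thesis
      using Suc by (simp add: traj_kernel_def[abs_def])
  qed
qed (auto simp: traj_kernel_def intro: measure_pmf.prob_space_axioms)

definition trajectory ::
  "('s \<Rightarrow> 'a \<Rightarrow> 's pmf) \<Rightarrow> ('s \<Rightarrow> 'a) \<Rightarrow> 's \<Rightarrow> 'a \<Rightarrow> (nat \<Rightarrow> 's \<times> 'a) measure"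
  where
  "trajectory P \<pi> s a =
     projective_family.lim UNIV (Ionescu_Tulcea.CI (traj_kernel P \<pi> s a) (\<lambda>_. count_space UNIV))
       (\<lambda>_. count_space UNIV)"

definition q_function ::
  "('s \<Rightarrow> 'a \<Rightarrow> 's pmf) \<Rightarrow> ('s \<Rightarrow> 'a \<Rightarrow> 's \<Rightarrow> real) \<Rightarrow> real \<Rightarrow> ('s \<Rightarrow> 'a) \<Rightarrow> real ^ ('s::finite \<times> 'a::finite)"
  where
  "q_function P r \<gamma> \<pi> = (\<chi> i. \<integral>\<omega>.
      (\<Sum>k. \<gamma> ^ k * r (fst (\<omega> k)) (snd (\<omega> k)) (fst (\<omega> (Suc k)))) \<partial>trajectory P \<pi> (fst i) (snd i))"

text \<open>Optimality: the value \<open>V\<^sup>\<pi>(s) = Q\<^sup>\<pi>(s, \<pi>(s))\<close> is maximal in every state.\<close>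

definition optimal_policy ::
  "('s::finite \<Rightarrow> 'a::finite \<Rightarrow> 's pmf) \<Rightarrow> ('s \<Rightarrow> 'a \<Rightarrow> 's \<Rightarrow> real) \<Rightarrow> real \<Rightarrow> ('s \<Rightarrow> 'a) \<Rightarrow> bool"
  where
  "optimal_policy P r \<gamma> \<pi> \<longleftrightarrow>
     (\<forall>\<pi>' s. q_function P r \<gamma> \<pi>' $ (s, \<pi>' s) \<le> q_function P r \<gamma> \<pi> $ (s, \<pi> s))"

text \<open>
  Ergodicity: under each policy the state converges in law to a stationary distribution that
  does not depend on the initial state. This holds in particular if each policy induces an
  irreducible aperiodic chain.
\<close>

definition ergodic_mdp :: "('s::finite \<Rightarrow> 'a::finite \<Rightarrow> 's pmf) \<Rightarrow> bool" where
  "ergodic_mdp P \<longleftrightarrow> (\<forall>\<pi>. \<exists>\<mu> :: 's pmf. \<forall>s s'.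
     (\<lambda>k. measure (trajectory P \<pi> s (\<pi> s)) {\<omega>. fst (\<omega> k) = s'}) \<longlonglongrightarrow> pmf \<mu> s')"

definition sample_pmf ::
  "('s \<Rightarrow> 'a \<Rightarrow> 's pmf) \<Rightarrow> 's pmf \<Rightarrow> ('s \<Rightarrow> 'a pmf) \<Rightarrow> ('s \<times> 'a \<times> 's) pmf"
  where
  "sample_pmf P p \<beta> = do {
     s \<leftarrow> p;
     a \<leftarrow> \<beta> s;
     s' \<leftarrow> P s a;
     return_pmf (s, a, s')
   }"

text \<open>
  \<open>X k\<close> is the sample \<open>(s\<^sub>k, a\<^sub>k, s\<^sub>k')\<close>; the past of step \<open>k\<close> is the \<open>\<sigma>\<close>-algebra
  generated jointly by the initial iterate and the samples \<open>X 0, \<dots>, X (k - 1)\<close>. (The library's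
  \<open>indep_var\<close> does not apply, as it wants two variables of the same type.)
\<close>

definition iid_sampling ::
  "'w measure \<Rightarrow> ('s \<Rightarrow> 'a \<Rightarrow> 's pmf) \<Rightarrow> 's pmf \<Rightarrow> ('s \<Rightarrow> 'a pmf) \<Rightarrow>
    ('w \<Rightarrow> real ^ ('s::finite \<times> 'a::finite)) \<Rightarrow> (nat \<Rightarrow> 'w \<Rightarrow> 's \<times> 'a \<times> 's) \<Rightarrow> bool"
  where
  "iid_sampling M P p \<beta> Q0 X \<longleftrightarrow>
     (\<forall>k. X k \<in> measurable M (count_space UNIV) \<and>
          distr M (count_space UNIV) (X k) = measure_pmf (sample_pmf P p \<beta>) \<and>
          prob_space.indep_set M
            (sets (vimage_algebra (space M) (\<lambda>\<omega>. (Q0 \<omega>, \<lambda>i\<in>{..<k}. X i \<omega>))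
              (borel \<Otimes>\<^sub>M PiM {..<k} (\<lambda>_. count_space UNIV))))
            (sets (vimage_algebra (space M) (X k) (count_space UNIV))))"

definition q_update ::
  "('s \<Rightarrow> 'a \<Rightarrow> 's \<Rightarrow> real) \<Rightarrow> real \<Rightarrow> real \<Rightarrow> 's \<times> 'a \<times> 's \<Rightarrow>
    real ^ ('s::finite \<times> 'a::finite) \<Rightarrow> real ^ ('s \<times> 'a)"
  where
  "q_update r \<gamma> \<alpha> = (\<lambda>(s, a, s') Q. \<chi> i.
     if i = (s, a) then Q $ i + \<alpha> * (r s a s' + \<gamma> * (MAX u. Q $ (s', u)) - Q $ i) else Q $ i)"

primrec q_iterate ::
  "('s \<Rightarrow> 'a \<Rightarrow> 's \<Rightarrow> real) \<Rightarrow> real \<Rightarrow> real \<Rightarrow> ('w \<Rightarrow> real ^ ('s::finite \<times> 'a::finite)) \<Rightarrow>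
    (nat \<Rightarrow> 'w \<Rightarrow> 's \<times> 'a \<times> 's) \<Rightarrow> nat \<Rightarrow> 'w \<Rightarrow> real ^ ('s \<times> 'a)"
  where
  "q_iterate r \<gamma> \<alpha> Q0 X 0 \<omega> = Q0 \<omega>"
| "q_iterate r \<gamma> \<alpha> Q0 X (Suc k) \<omega> = q_update r \<gamma> \<alpha> (X k \<omega>) (q_iterate r \<gamma> \<alpha> Q0 X k \<omega>)"

definition q_average ::
  "('s \<Rightarrow> 'a \<Rightarrow> 's \<Rightarrow> real) \<Rightarrow> real \<Rightarrow> real \<Rightarrow> ('w \<Rightarrow> real ^ ('s::finite \<times> 'a::finite)) \<Rightarrow>
    (nat \<Rightarrow> 'w \<Rightarrow> 's \<times> 'a \<times> 's) \<Rightarrow> nat \<Rightarrow> 'w \<Rightarrow> real ^ ('s \<times> 'a)"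
  where
  "q_average r \<gamma> \<alpha> Q0 X N \<omega> = (1 / real N) *\<^sub>R (\<Sum>i<N. q_iterate r \<gamma> \<alpha> Q0 X i \<omega>)"

definition sa_dist :: "'s pmf \<Rightarrow> ('s \<Rightarrow> 'a pmf) \<Rightarrow> 's \<times> 'a \<Rightarrow> real" where
  "sa_dist p \<beta> = (\<lambda>(s, a). pmf p s * pmf (\<beta> s) a)"

end

theory Submission
  imports Defs
begin

text \<open>
  Write \<open>d(i)\<close> for the probability of sampling the pair \<open>i\<close> and \<open>F\<close> for the Bellman optimality
  operator, a \<open>\<gamma>\<close>-contraction in the maximum norm with fixed point \<open>Q*\<close>. Given the past, the step
  from \<open>Q\<^sub>k\<close> moves coordinate \<open>i\<close> on average by \<open>\<alpha> d(i) (F(Q\<^sub>k) - Q\<^sub>k)(i)\<close>; what remains is \<open>\<alpha>\<close> times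
  a centred noise term \<open>w\<^sub>k(i)\<close>. The error \<open>Q\<^sub>k - Q*\<close> is split as \<open>y\<^sub>k + z\<^sub>k\<close>, where
  \<open>y\<^sub>0 = Q\<^sub>0 - Q*\<close>, \<open>z\<^sub>0 = 0\<close> and
    \<open>y\<^sub>k\<^sub>+\<^sub>1(i) = (1 - \<alpha> d(i)) y\<^sub>k(i) + \<alpha> w\<^sub>k(i)\<close>,
    \<open>z\<^sub>k\<^sub>+\<^sub>1(i) = (1 - \<alpha> d(i)) z\<^sub>k(i) + \<alpha> d(i) (F(Q\<^sub>k) - F(Q*))(i)\<close>.
  The two parts are called \<open>noise\<close> and \<open>drift\<close> below.

  The noise part is a linear recursion whose coordinates decouple. Since \<open>w\<^sub>k\<close> is centred given the
  past and has second moment at most \<open>d(i) (2 / (1 - \<gamma>))\<^sup>2\<close>, the cross term vanishes and the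
  second moment of \<open>y\<^sub>k(i)\<close> contracts by \<open>1 - \<alpha> d(i)\<close> up to an additive \<open>\<alpha>\<^sup>2 d(i) (2 / (1 - \<gamma>))\<^sup>2\<close>.
  Summing over time, its average over \<open>k < N\<close> is of order
  \<open>(\<alpha> + 1 / (N \<alpha>)) / d\<^sub>m\<^sub>i\<^sub>n\<close> (\<open>sum_noise_second_moment\<close>).

  The drift part carries no randomness of its own: because
  \<open>\<bar>F(Q\<^sub>k) - F(Q*)\<bar> \<le> \<gamma> (\<bar>y\<^sub>k\<bar> + \<bar>z\<^sub>k\<bar>)\<close>, its maximum norm contracts by
  \<open>1 - \<alpha> d\<^sub>m\<^sub>i\<^sub>n (1 - \<gamma>)\<close> and is fed by \<open>\<alpha> \<gamma> d\<^sub>m\<^sub>a\<^sub>x \<bar>y\<^sub>k\<bar>\<close>. Hence on every sample path the norms of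
  the \<open>z\<^sub>k\<close> sum to at most \<open>\<gamma> d\<^sub>m\<^sub>a\<^sub>x / (d\<^sub>m\<^sub>i\<^sub>n (1 - \<gamma>))\<close> times those of the \<open>y\<^sub>k\<close>
  (\<open>sum_drift_le_sum_noise\<close>). This factor plus one, and the root of the average second moment, give
  \<open>expected_average_error\<close>; the stated rate is weaker by elementary estimates (\<open>rate_constant_le\<close>).

  It remains to know that \<open>Q*\<close>, defined through expected discounted rewards along trajectories, is
  the fixed point of \<open>F\<close> (\<open>optimal_q_function_Bellman\<close>). The Markov property of the trajectory measure
  gives the Bellman equation of a fixed policy, and an optimal policy must be greedy for its own
  Q-function, since otherwise changing it in one state would improve it.
\<close>

section \<open>Trajectories under a fixed policy\<close>

definition policy_kernel ::
  "('s \<Rightarrow> 'a \<Rightarrow> 's pmf) \<Rightarrow> ('s \<Rightarrow> 'a) \<Rightarrow> 's \<times> 'a \<Rightarrow> ('s \<times> 'a) pmf" where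
  "policy_kernel P \<pi> x = map_pmf (\<lambda>s'. (s', \<pi> s')) (P (fst x) (snd x))"

primrec visit_pmf ::
  "('s \<Rightarrow> 'a \<Rightarrow> 's pmf) \<Rightarrow> ('s \<Rightarrow> 'a) \<Rightarrow> nat \<Rightarrow> 's \<times> 'a \<Rightarrow> ('s \<times> 'a) pmf" where
  "visit_pmf P \<pi> 0 x = return_pmf x"
| "visit_pmf P \<pi> (Suc k) x = bind_pmf (policy_kernel P \<pi> x) (visit_pmf P \<pi> k)"

text \<open>
  The recursion of \<open>visit_pmf\<close> branches on the first step, which is what the Bellman equation needs;
  the trajectory measure is built by appending a last step, so the other form is needed as well.
\<close>

lemma visit_pmf_Suc_right:
  "visit_pmf P \<pi> (Suc k) x = bind_pmf (visit_pmf P \<pi> k x) (policy_kernel P \<pi>)"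
proof (induction k arbitrary: x)
  case 0
  have "visit_pmf P \<pi> 0 = return_pmf" by (simp add: fun_eq_iff)
  then show ?case by (simp add: bind_return_pmf bind_return_pmf')
next
  case (Suc k)
  have "visit_pmf P \<pi> (Suc (Suc k)) x
      = bind_pmf (policy_kernel P \<pi> x) (\<lambda>y. bind_pmf (visit_pmf P \<pi> k y) (policy_kernel P \<pi>))"
    unfolding visit_pmf.simps(2)[of _ _ "Suc k"] by (intro bind_pmf_cong refl) (rule Suc.IH)
  then show ?case by (simp add: bind_assoc_pmf)
qed

text \<open>
  The Markov property. The law of the first \<open>n\<close> coordinates is the \<open>n\<close>-fold composition \<open>C\<close> of the
  kernels, because the trajectory measure is their projective limit; and the last kernel applied in
  \<open>C\<close> depends on the path only through its last coordinate.
\<close>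

lemma
  fixes P :: "'s::finite \<Rightarrow> 'a::finite \<Rightarrow> 's pmf"
  shows sets_trajectory: "sets (trajectory P \<pi> s a) = sets (PiM UNIV (\<lambda>_. count_space UNIV))"
    and prob_space_trajectory: "prob_space (trajectory P \<pi> s a)"
    and nn_integral_trajectory_start:
      "(\<integral>\<^sup>+\<omega>. h (\<omega> 0) \<partial>trajectory P \<pi> s a) = h (s, a)"
    and nn_integral_trajectory_step:
      "(\<integral>\<^sup>+\<omega>. f (\<omega> k) (\<omega> (Suc k)) \<partial>trajectory P \<pi> s a)
        = (\<integral>\<^sup>+\<omega>. (\<integral>\<^sup>+y. f (\<omega> k) y \<partial>policy_kernel P \<pi> (\<omega> k)) \<partial>trajectory P \<pi> s a)"
proof -
  let ?M = "\<lambda>_ :: nat. count_space (UNIV :: ('s \<times> 'a) set)"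
  interpret Ionescu_Tulcea "traj_kernel P \<pi> s a" ?M
    by (rule Ionescu_Tulcea_traj_kernel)
  let ?T = "trajectory P \<pi> s a"
  have T: "?T = PF.lim"
    by (simp add: trajectory_def)
  show sets_T[simp, measurable_cong]: "sets ?T = sets (PiM UNIV ?M)"
    by (simp add: T)
  have space_T[simp]: "space ?T = UNIV"
    by (simp add: T space_PiM)
  let ?C = "\<lambda>n. C 0 n (\<lambda>_. undefined)"
  have sets_C': "sets (?C n) = sets (PiM {0..<n} ?M)" for n
    using sets_C[of "\<lambda>_. undefined" 0 n] by (simp add: space_PiM)
  have space_C': "space (?C n) = space (PiM {0..<n} ?M)" for n
    using sets_C'[of n] by (rule sets_eq_imp_space_eq)
  have prefix: "(\<integral>\<^sup>+\<omega>. f (restrict \<omega> {0..<n}) \<partial>?T) = (\<integral>\<^sup>+\<omega>. f \<omega> \<partial>?C n)"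
    if f: "f \<in> borel_measurable (PiM {0..<n} ?M)" for n and f :: "_ \<Rightarrow> ennreal"
  proof -
    have le: "n \<le> up_to {0..<n}"
      using up_to_less[of "{0..<n}" "n - 1"] by (cases n) auto
    have "distr ?T (PiM {0..<n} ?M) (\<lambda>\<omega>. restrict \<omega> {0..<n}) = CI {0..<n}"
      unfolding T by (rule distr_lim) simp
    also have "\<dots> = ?C n"
      using distr_C[of n "up_to {0..<n}" "\<lambda>_. undefined" 0] le by (simp add: CI_def space_PiM)
    finally have D: "distr ?T (PiM {0..<n} ?M) (\<lambda>\<omega>. restrict \<omega> {0..<n}) = ?C n" .
    show ?thesis
      unfolding D[symmetric] using f by (subst nn_integral_distr) (auto intro!: measurable_restrict)
  qed
  have extend: "(\<integral>\<^sup>+\<omega>. f \<omega> \<partial>?C (Suc n))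
      = (\<integral>\<^sup>+\<omega>. (\<integral>\<^sup>+y. f (fun_upd \<omega> n y) \<partial>traj_kernel P \<pi> s a n \<omega>) \<partial>?C n)"
    if f: "f \<in> borel_measurable (PiM {0..<Suc n} ?M)" for n and f :: "_ \<Rightarrow> ennreal"
  proof -
    have "eP n \<in> measurable (?C n) (subprob_algebra (PiM {0..<Suc n} ?M))"
      by (subst measurable_cong_sets[OF sets_C' refl]) (rule measurable_eP)
    then have "(\<integral>\<^sup>+\<omega>. f \<omega> \<partial>?C (Suc n)) = (\<integral>\<^sup>+\<omega>. \<integral>\<^sup>+x. f x \<partial>eP n \<omega> \<partial>?C n)"
      unfolding C.simps add_0 by (rule nn_integral_bind[OF f])
    also have "\<dots> = (\<integral>\<^sup>+\<omega>. (\<integral>\<^sup>+y. f (fun_upd \<omega> n y) \<partial>traj_kernel P \<pi> s a n \<omega>) \<partial>?C n)"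
      by (intro nn_integral_cong nn_integral_eP f) (simp add: space_C')
    finally show ?thesis .
  qed
  have comp[measurable]: "(\<lambda>\<omega>. \<omega> j) \<in> measurable (PiM {0..<n} ?M) (count_space UNIV)" if "j < n" for j n
    using that by (intro measurable_component_singleton) simp
  have start: "(\<integral>\<^sup>+\<omega>. h (\<omega> 0) \<partial>?T) = h (s, a)" for h :: "_ \<Rightarrow> ennreal"
  proof -
    have m: "(\<lambda>\<omega>. h (\<omega> 0)) \<in> borel_measurable (PiM {0..<Suc 0} ?M)"
      by (rule measurable_compose[OF comp, where g = h]) simp_all
    have "(\<integral>\<^sup>+\<omega>. h (\<omega> 0) \<partial>?T) = (\<integral>\<^sup>+\<omega>. h (\<omega> 0) \<partial>?C (Suc 0))"
      using prefix[OF m] by (simp del: C.simps)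
    also have "\<dots> = (\<integral>\<^sup>+\<omega>. (\<integral>\<^sup>+y. h y \<partial>traj_kernel P \<pi> s a 0 \<omega>) \<partial>?C 0)"
      unfolding extend[OF m] by (simp del: C.simps)
    also have "\<dots> = h (s, a)"
      using prob_space_C[of "\<lambda>_. undefined" 0 0]
      by (simp add: traj_kernel_def space_PiM prob_space.emeasure_space_1 del: C.simps)
    finally show ?thesis .
  qed
  then show "(\<integral>\<^sup>+\<omega>. h (\<omega> 0) \<partial>?T) = h (s, a)" .
  show "prob_space ?T"
    using start[of "\<lambda>_. 1"] by (intro prob_spaceI) simp
  show "(\<integral>\<^sup>+\<omega>. f (\<omega> k) (\<omega> (Suc k)) \<partial>?T)
      = (\<integral>\<^sup>+\<omega>. (\<integral>\<^sup>+y. f (\<omega> k) y \<partial>policy_kernel P \<pi> (\<omega> k)) \<partial>?T)"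
  proof -
    have m: "(\<lambda>\<omega>. f (\<omega> k) (\<omega> (Suc k))) \<in> borel_measurable (PiM {0..<Suc (Suc k)} ?M)"
    proof -
      have "(\<lambda>\<omega>. (\<omega> k, \<omega> (Suc k))) \<in> measurable (PiM {0..<Suc (Suc k)} ?M)
          (count_space UNIV \<Otimes>\<^sub>M count_space UNIV)"
        by (intro measurable_Pair comp) simp_all
      then have "(\<lambda>\<omega>. (\<omega> k, \<omega> (Suc k))) \<in> measurable (PiM {0..<Suc (Suc k)} ?M) (count_space UNIV)"
        by (simp add: pair_measure_countable)
      from measurable_compose[OF this, of "\<lambda>z. f (fst z) (snd z)" borel] show ?thesis by simp
    qed
    have m': "(\<lambda>\<omega>. \<integral>\<^sup>+y. f (\<omega> k) y \<partial>policy_kernel P \<pi> (\<omega> k)) \<in> borel_measurable (PiM {0..<Suc k} ?M)"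
      by (rule measurable_compose[OF comp, where g = "\<lambda>x. \<integral>\<^sup>+y. f x y \<partial>policy_kernel P \<pi> x"])
         simp_all
    have "(\<integral>\<^sup>+\<omega>. f (\<omega> k) (\<omega> (Suc k)) \<partial>?T) = (\<integral>\<^sup>+\<omega>. f (\<omega> k) (\<omega> (Suc k)) \<partial>?C (Suc (Suc k)))"
      using prefix[OF m] by (simp del: C.simps)
    also have "\<dots> = (\<integral>\<^sup>+\<omega>. (\<integral>\<^sup>+y. f (\<omega> k) y \<partial>policy_kernel P \<pi> (\<omega> k)) \<partial>?C (Suc k))"
      unfolding extend[OF m] by (simp add: traj_kernel_def policy_kernel_def del: C.simps)
    also have "\<dots> = (\<integral>\<^sup>+\<omega>. (\<integral>\<^sup>+y. f (\<omega> k) y \<partial>policy_kernel P \<pi> (\<omega> k)) \<partial>?T)"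
      using prefix[OF m'] by (simp del: C.simps)
    finally show ?thesis .
  qed
qed

lemma nn_integral_trajectory_visit:
  fixes P :: "'s::finite \<Rightarrow> 'a::finite \<Rightarrow> 's pmf"
  shows "(\<integral>\<^sup>+\<omega>. h (\<omega> k) \<partial>trajectory P \<pi> s a) = (\<integral>\<^sup>+y. h y \<partial>visit_pmf P \<pi> k (s, a))"
proof (induction k arbitrary: h)
  case 0
  show ?case by (simp add: nn_integral_trajectory_start)
next
  case (Suc k)
  show ?case
    unfolding nn_integral_trajectory_step[where f = "\<lambda>_. h"] visit_pmf_Suc_right nn_integral_bind_pmf
    by (rule Suc.IH)
qed

text \<open>
  One reward depends on two consecutive coordinates, whence the joint law.
\<close>

lemma distr_trajectory_transition:
  fixes P :: "'s::finite \<Rightarrow> 'a::finite \<Rightarrow> 's pmf"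
  shows "distr (trajectory P \<pi> s a) (count_space UNIV) (\<lambda>\<omega>. (\<omega> k, \<omega> (Suc k)))
    = measure_pmf (bind_pmf (visit_pmf P \<pi> k (s, a)) (\<lambda>x. map_pmf (Pair x) (policy_kernel P \<pi> x)))"
    (is "?L = ?R")
  and measurable_trajectory_transition:
    "(\<lambda>\<omega>. (\<omega> k, \<omega> (Suc k))) \<in> measurable (trajectory P \<pi> s a) (count_space UNIV)"
proof -
  show m: "(\<lambda>\<omega>. (\<omega> k, \<omega> (Suc k))) \<in> measurable (trajectory P \<pi> s a) (count_space UNIV)"
  proof -
    have "(\<lambda>\<omega>. (\<omega> k, \<omega> (Suc k))) \<in> measurable (PiM UNIV (\<lambda>_. count_space UNIV))
        (count_space UNIV \<Otimes>\<^sub>M count_space (UNIV :: ('s \<times> 'a) set))"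
      by (intro measurable_Pair measurable_component_singleton) simp_all
    then show ?thesis
      by (simp add: pair_measure_countable measurable_cong_sets[OF sets_trajectory refl])
  qed
  show "?L = ?R"
  proof (rule measure_eqI)
    fix A
    have "emeasure ?L A = (\<integral>\<^sup>+z. indicator A z \<partial>?L)"
      by (simp add: nn_integral_indicator)
    also have "\<dots> = (\<integral>\<^sup>+\<omega>. indicator A (\<omega> k, \<omega> (Suc k)) \<partial>trajectory P \<pi> s a)"
      by (rule nn_integral_distr[OF m]) simp
    also have "\<dots> = (\<integral>\<^sup>+z. indicator A z \<partial>?R)"
      unfolding nn_integral_trajectory_step[where f = "\<lambda>x y. indicator A (x, y)"]
        nn_integral_trajectory_visit[where h = "\<lambda>x. \<integral>\<^sup>+y. indicator A (x, y) \<partial>policy_kernel P \<pi> x"]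
      by (simp only: nn_integral_bind_pmf nn_integral_map_pmf)
    finally show "emeasure ?L A = emeasure ?R A"
      by (simp del: nn_integral_bind_pmf nn_integral_map_pmf)
  qed simp
qed

section \<open>The Bellman optimality equation\<close>

definition expected_reward ::
  "('s::finite \<Rightarrow> 'a \<Rightarrow> 's pmf) \<Rightarrow> ('s \<Rightarrow> 'a \<Rightarrow> 's \<Rightarrow> real) \<Rightarrow> 's \<times> 'a \<Rightarrow> real" where
  "expected_reward P r x = (\<Sum>s'\<in>UNIV. pmf (P (fst x) (snd x)) s' * r (fst x) (snd x) s')"

lemma expectation_bind_finite:
  fixes p :: "'x::finite pmf" and q :: "'x \<Rightarrow> 'y::finite pmf" and f :: "'y \<Rightarrow> real"
  shows "measure_pmf.expectation (bind_pmf p q) f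
    = (\<Sum>x\<in>UNIV. pmf p x * measure_pmf.expectation (q x) f)"
  by (subst pmf_expectation_bind[where A = UNIV]) simp_all

lemma expectation_finite:
  fixes p :: "'x::finite pmf" and f :: "'x \<Rightarrow> real"
  shows "measure_pmf.expectation p f = (\<Sum>x\<in>UNIV. pmf p x * f x)"
  by (subst integral_measure_pmf[where A = UNIV]) simp_all

lemma expectation_visit_Suc:
  fixes P :: "'s::finite \<Rightarrow> 'a::finite \<Rightarrow> 's pmf" and f :: "'s \<times> 'a \<Rightarrow> real"
  shows "measure_pmf.expectation (visit_pmf P \<pi> (Suc k) x) f
    = (\<Sum>s'\<in>UNIV. pmf (P (fst x) (snd x)) s' * measure_pmf.expectation (visit_pmf P \<pi> k (s', \<pi> s')) f)"
  by (simp add: policy_kernel_def bind_map_pmf expectation_bind_finite)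

text \<open>
  Exchanges expectation and discounted sum; the geometric series of \<open>\<gamma>\<close> dominates the rewards.
\<close>

lemma q_function_series:
  fixes P :: "'s::finite \<Rightarrow> 'a::finite \<Rightarrow> 's pmf"
  assumes \<gamma>: "0 \<le> \<gamma>" "\<gamma> < 1" and r: "\<And>s a s'. \<bar>r s a s'\<bar> \<le> 1"
  shows "(\<lambda>k. \<gamma> ^ k * measure_pmf.expectation (visit_pmf P \<pi> k x) (expected_reward P r))
    sums (q_function P r \<gamma> \<pi> $ x)"
proof -
  obtain s a where x: "x = (s, a)" by (cases x)
  let ?T = "trajectory P \<pi> s a"
  interpret T: prob_space ?T by (rule prob_space_trajectory)
  let ?R = "\<lambda>z. r (fst (fst z)) (snd (fst z)) (fst (snd z))"
  let ?f = "\<lambda>k \<omega>. \<gamma> ^ k * ?R (\<omega> k, \<omega> (Suc k))"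
  have meas: "?f k \<in> borel_measurable ?T" for k
    by (intro borel_measurable_times borel_measurable_const
        measurable_compose[OF measurable_trajectory_transition]) simp
  have bound: "\<bar>?f k \<omega>\<bar> \<le> \<gamma> ^ k" for k \<omega>
    using \<gamma> r mult_left_mono[OF r, of "\<gamma> ^ k"] by (simp add: abs_mult)
  have int: "integrable ?T (?f k)" for k
    by (rule T.integrable_const_bound[where B = "\<gamma> ^ k"]) (use bound meas in auto)
  have geo: "summable (\<lambda>k. \<gamma> ^ k)"
    using \<gamma> by (simp add: summable_geometric)
  have "(\<lambda>k. \<integral>\<omega>. ?f k \<omega> \<partial>?T) sums (\<integral>\<omega>. (\<Sum>k. ?f k \<omega>) \<partial>?T)"
  proof (rule sums_integral)
    show "AE \<omega> in ?T. summable (\<lambda>k. norm (?f k \<omega>))"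
      using bound by (intro AE_I2 summable_comparison_test'[OF geo, of 0]) simp
    have "(\<integral>\<omega>. norm (?f k \<omega>) \<partial>?T) \<le> (\<integral>\<omega>. \<gamma> ^ k \<partial>?T)" for k
      using bound int by (intro integral_mono) auto
    then show "summable (\<lambda>k. \<integral>\<omega>. norm (?f k \<omega>) \<partial>?T)"
      by (intro summable_comparison_test'[OF geo, of 0]) (simp add: T.prob_space)
  qed (rule int)
  moreover have "(\<integral>\<omega>. ?f k \<omega> \<partial>?T)
      = \<gamma> ^ k * measure_pmf.expectation (visit_pmf P \<pi> k x) (expected_reward P r)" for k
  proof -
    have "(\<integral>\<omega>. ?R (\<omega> k, \<omega> (Suc k)) \<partial>?T)
        = (\<integral>z. ?R z \<partial>distr ?T (count_space UNIV) (\<lambda>\<omega>. (\<omega> k, \<omega> (Suc k))))"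
      by (rule integral_distr[symmetric, OF measurable_trajectory_transition]) simp
    also have "\<dots> = measure_pmf.expectation (visit_pmf P \<pi> k x) (expected_reward P r)"
      unfolding distr_trajectory_transition x
      unfolding expectation_bind_finite policy_kernel_def integral_map_pmf
      by (simp add: expectation_finite expected_reward_def)
    finally show ?thesis by simp
  qed
  ultimately show ?thesis
    by (simp only: q_function_def x vec_lambda_beta fst_conv snd_conv)
qed

text \<open>
  Branching the series of expected rewards on the first transition: the terms after the first are
  \<open>\<gamma>\<close> times the series started at the pair that the transition reaches.
\<close>

lemma q_function_Bellman:
  fixes P :: "'s::finite \<Rightarrow> 'a::finite \<Rightarrow> 's pmf"
  assumes \<gamma>: "0 \<le> \<gamma>" "\<gamma> < 1" and r: "\<And>s a s'. \<bar>r s a s'\<bar> \<le> 1"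
  shows "q_function P r \<gamma> \<pi> $ (s, a)
    = (\<Sum>s'\<in>UNIV. pmf (P s a) s' * (r s a s' + \<gamma> * q_function P r \<gamma> \<pi> $ (s', \<pi> s')))"
proof -
  let ?e = "\<lambda>k x. measure_pmf.expectation (visit_pmf P \<pi> k x) (expected_reward P r)"
  let ?Q = "q_function P r \<gamma> \<pi>"
  note series = q_function_series[where P = P and \<pi> = \<pi>, OF assms]
  have "(\<lambda>k. \<gamma> ^ Suc k * ?e (Suc k) (s, a))
      sums (\<gamma> * (\<Sum>s'\<in>UNIV. pmf (P s a) s' * ?Q $ (s', \<pi> s')))"
  proof -
    have "(\<lambda>k. \<gamma> * (\<Sum>s'\<in>UNIV. pmf (P s a) s' * (\<gamma> ^ k * ?e k (s', \<pi> s'))))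
        sums (\<gamma> * (\<Sum>s'\<in>UNIV. pmf (P s a) s' * ?Q $ (s', \<pi> s')))"
      by (intro sums_mult sums_sum series)
    then show ?thesis
      unfolding expectation_visit_Suc by (simp add: sum_distrib_left mult.assoc mult.left_commute)
  qed
  moreover have "?e 0 (s, a) = (\<Sum>s'\<in>UNIV. pmf (P s a) s' * r s a s')"
    by (simp add: expected_reward_def)
  ultimately have "?Q $ (s, a) = (\<Sum>s'\<in>UNIV. pmf (P s a) s' * r s a s')
      + \<gamma> * (\<Sum>s'\<in>UNIV. pmf (P s a) s' * ?Q $ (s', \<pi> s'))"
    using sums_unique2[OF series[of "(s, a)"] sums_Suc[of "\<lambda>k. \<gamma> ^ k * ?e k (s, a)"]]
    by (simp del: visit_pmf.simps)
  also have "\<dots> = (\<Sum>s'\<in>UNIV. pmf (P s a) s' * (r s a s' + \<gamma> * ?Q $ (s', \<pi> s')))"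
    unfolding sum_distrib_left sum.distrib[symmetric]
    by (intro sum.cong refl) (simp add: distrib_left mult.left_commute)
  finally show ?thesis .
qed

lemma pmf_average_le:
  fixes p :: "'x::finite pmf" and f :: "'x \<Rightarrow> real"
  assumes "\<And>x. f x \<le> c"
  shows "(\<Sum>x\<in>UNIV. pmf p x * f x) \<le> c"
proof -
  have "(\<Sum>x\<in>UNIV. pmf p x * f x) \<le> (\<Sum>x\<in>UNIV. pmf p x * c)"
    by (intro sum_mono mult_left_mono assms) simp
  also have "\<dots> = c"
    by (simp add: sum_distrib_right[symmetric] sum_pmf_eq_1)
  finally show ?thesis .
qed

text \<open>
  Policy improvement. Let \<open>m\<close> be the largest loss incurred by passing from \<open>\<pi>\<close> to \<open>\<pi>'\<close>. After one
  transition the value of \<open>\<pi>\<close> is at most the value of first playing \<open>\<pi>'\<close> and then \<open>\<pi>\<close>, which exceeds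
  that of \<open>\<pi>'\<close> by at most \<open>m\<close>. So \<open>m \<le> \<gamma> m\<close>, which forces \<open>m \<le> 0\<close>.
\<close>

lemma greedy_policy_improves:
  fixes P :: "'s::finite \<Rightarrow> 'a::finite \<Rightarrow> 's pmf"
  assumes \<gamma>: "0 \<le> \<gamma>" "\<gamma> < 1" and r: "\<And>s a s'. \<bar>r s a s'\<bar> \<le> 1"
    and greedy: "\<And>s. q_function P r \<gamma> \<pi> $ (s, \<pi> s) \<le> q_function P r \<gamma> \<pi> $ (s, \<pi>' s)"
  shows "q_function P r \<gamma> \<pi> $ x \<le> q_function P r \<gamma> \<pi>' $ x"
proof -
  let ?d = "\<lambda>x. q_function P r \<gamma> \<pi> $ x - q_function P r \<gamma> \<pi>' $ x"
  define m where "m = (MAX x. ?d x)"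
  have d_le: "?d x \<le> m" for x
    unfolding m_def by (rule Max_ge) auto
  have "?d (s, a) \<le> \<gamma> * m" for s a
  proof -
    have "?d (s, a) = (\<Sum>s'\<in>UNIV. pmf (P s a) s' *
        (\<gamma> * (q_function P r \<gamma> \<pi> $ (s', \<pi> s') - q_function P r \<gamma> \<pi>' $ (s', \<pi>' s'))))"
      unfolding q_function_Bellman[OF \<gamma> r, where s = s and a = a]
      by (simp add: sum_subtractf sum.distrib right_diff_distrib distrib_left)
    also have "\<dots> \<le> \<gamma> * m"
    proof (intro pmf_average_le mult_left_mono \<gamma>)
      fix s' show "q_function P r \<gamma> \<pi> $ (s', \<pi> s') - q_function P r \<gamma> \<pi>' $ (s', \<pi>' s') \<le> m"
        using d_le[of "(s', \<pi>' s')"] greedy[of s'] by linarith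
    qed
    finally show ?thesis .
  qed
  then have "m \<le> \<gamma> * m"
    unfolding m_def by (subst Max_le_iff) auto
  then have "m \<le> 0"
    using \<gamma> mult_less_cancel_right2[of \<gamma> m] by linarith
  then show ?thesis
    using d_le[of x] by linarith
qed

text \<open>
  If some action \<open>u\<close> beat \<open>\<pi> s\<close> in the state \<open>s\<close>, then \<open>\<pi>(s := u)\<close> would have a larger value there.
\<close>

lemma optimal_policy_greedy:
  fixes P :: "'s::finite \<Rightarrow> 'a::finite \<Rightarrow> 's pmf"
  assumes \<gamma>: "0 \<le> \<gamma>" "\<gamma> < 1" and r: "\<And>s a s'. \<bar>r s a s'\<bar> \<le> 1"
    and opt: "optimal_policy P r \<gamma> \<pi>"
  shows "q_function P r \<gamma> \<pi> $ (s, \<pi> s) = (MAX u. q_function P r \<gamma> \<pi> $ (s, u))"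
proof (rule Max_eqI[symmetric])
  let ?Q = "q_function P r \<gamma> \<pi>"
  fix y assume "y \<in> range (\<lambda>u. ?Q $ (s, u))"
  then obtain u where y: "y = ?Q $ (s, u)" by auto
  show "y \<le> ?Q $ (s, \<pi> s)"
  proof (rule ccontr)
    assume less: "\<not> y \<le> ?Q $ (s, \<pi> s)"
    have "?Q $ (s, u) \<le> q_function P r \<gamma> (\<pi>(s := u)) $ (s, u)"
      using less y by (intro greedy_policy_improves[OF \<gamma> r]) auto
    moreover have "q_function P r \<gamma> (\<pi>(s := u)) $ (s, (\<pi>(s := u)) s) \<le> ?Q $ (s, \<pi> s)"
      using opt unfolding optimal_policy_def by blast
    ultimately show False
      using less y by simp
  qed
qed auto

lemma optimal_q_function_Bellman:
  fixes P :: "'s::finite \<Rightarrow> 'a::finite \<Rightarrow> 's pmf"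
  assumes \<gamma>: "0 \<le> \<gamma>" "\<gamma> < 1" and r: "\<And>s a s'. \<bar>r s a s'\<bar> \<le> 1"
    and opt: "optimal_policy P r \<gamma> \<pi>"
  shows "q_function P r \<gamma> \<pi> $ (s, a) = (\<Sum>s'\<in>UNIV. pmf (P s a) s' *
    (r s a s' + \<gamma> * (MAX u. q_function P r \<gamma> \<pi> $ (s', u))))"
  unfolding optimal_policy_greedy[OF assms, symmetric] by (rule q_function_Bellman[OF \<gamma> r])

section \<open>Inequalities for sequences, averages and the maximum norm\<close>

text \<open>
  Telescoping: \<open>c u\<^sub>k \<le> u\<^sub>k - u\<^sub>k\<^sub>+\<^sub>1 + b\<^sub>k\<close>. It serves twice, for the second moments of the noise and for
  the norms of the drift.
\<close>

lemma contraction_sum_bound: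
  fixes u b :: "nat \<Rightarrow> real"
  assumes step: "\<And>k. u (Suc k) \<le> (1 - c) * u k + b k" and nonneg: "\<And>k. 0 \<le> u k"
  shows "c * (\<Sum>k<N. u k) \<le> u 0 + (\<Sum>k<N. b k)"
proof -
  have "c * (\<Sum>k<N. u k) \<le> u 0 - u N + (\<Sum>k<N. b k)"
  proof (induction N)
    case (Suc N)
    then show ?case
      using step[of N] by (simp add: algebra_simps)
  qed simp
  then show ?thesis
    using nonneg[of N] by linarith
qed

lemma abs_pmf_average_le:
  fixes p :: "'x::finite pmf" and f :: "'x \<Rightarrow> real"
  assumes "\<And>x. \<bar>f x\<bar> \<le> c"
  shows "\<bar>\<Sum>x\<in>UNIV. pmf p x * f x\<bar> \<le> c"
proof -
  have "\<bar>\<Sum>x\<in>UNIV. pmf p x * f x\<bar> \<le> (\<Sum>x\<in>UNIV. pmf p x * \<bar>f x\<bar>)"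
    by (rule order_trans[OF sum_abs]) (simp add: abs_mult)
  also have "\<dots> \<le> c"
    by (rule pmf_average_le) (rule assms)
  finally show ?thesis .
qed

text \<open>
  A centred perturbation is orthogonal to a constant, and centring only decreases a second moment.
\<close>

lemma pmf_centred_second_moment_le:
  fixes p :: "'x::finite pmf" and f :: "'x \<Rightarrow> real"
  assumes mean: "(\<Sum>x\<in>UNIV. pmf p x * f x) = m"
  shows "(\<Sum>x\<in>UNIV. pmf p x * (b + c * (f x - m))\<^sup>2)
    \<le> b\<^sup>2 + c\<^sup>2 * (\<Sum>x\<in>UNIV. pmf p x * (f x)\<^sup>2)"
proof -
  have expand: "w * (b + c * (y - m))\<^sup>2
      = (b - c * m)\<^sup>2 * w + 2 * (b - c * m) * c * (w * y) + c\<^sup>2 * (w * y\<^sup>2)" for w y :: real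
    by algebra
  have "(\<Sum>x\<in>UNIV. pmf p x * (b + c * (f x - m))\<^sup>2)
      = (b - c * m)\<^sup>2 + 2 * (b - c * m) * c * m + c\<^sup>2 * (\<Sum>x\<in>UNIV. pmf p x * (f x)\<^sup>2)"
    by (simp only: expand sum.distrib sum_distrib_left[symmetric] mean sum_pmf_eq_1[OF finite subset_UNIV] mult_1_right)
  also have "(b - c * m)\<^sup>2 + 2 * (b - c * m) * c * m = b\<^sup>2 - (c * m)\<^sup>2"
    by algebra
  also have "\<dots> \<le> b\<^sup>2" by simp
  finally show ?thesis by simp
qed

text \<open>
  Together with \<open>component_le_infnorm_cart\<close>, reduces estimates in the maximum norm to coordinates.
\<close>

lemma infnorm_le_cart:
  fixes x :: "real ^ 'n"
  assumes "\<And>i. \<bar>x $ i\<bar> \<le> c"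
  shows "infnorm x \<le> c"
  unfolding infnorm_cart using assms by (intro cSup_least) auto

lemma borel_measurable_cart:
  fixes f :: "'w \<Rightarrow> real ^ 'n"
  assumes "\<And>i. (\<lambda>\<omega>. f \<omega> $ i) \<in> borel_measurable M"
  shows "f \<in> borel_measurable M"
  by (rule borel_measurable_euclidean_space[THEN iffD2]) (auto simp: Basis_vec_def inner_axis assms)

lemma borel_measurable_nth_cart:
  fixes f :: "'w \<Rightarrow> real ^ 'n"
  assumes "f \<in> borel_measurable M"
  shows "(\<lambda>\<omega>. f \<omega> $ i) \<in> borel_measurable M"
  using measurable_compose[OF assms borel_measurable_continuous_onI[OF continuous_on_component[OF continuous_on_id]]] .

lemma abs_Max_diff_le:
  fixes f g :: "'x::finite \<Rightarrow> real"
  assumes "\<And>u. \<bar>f u - g u\<bar> \<le> c"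
  shows "\<bar>(MAX u. f u) - (MAX u. g u)\<bar> \<le> c"
proof -
  have *: "(MAX u. f u) \<le> (MAX u. g u) + c" if "\<And>u. \<bar>f u - g u\<bar> \<le> c" for f g :: "'x \<Rightarrow> real"
  proof -
    have "f u \<le> (MAX u. g u) + c" for u
    proof -
      have "g u \<le> (MAX u. g u)" by (rule Max_ge) auto
      then show ?thesis using that[of u] by linarith
    qed
    then show ?thesis by (subst Max_le_iff) auto
  qed
  have "(MAX u. f u) \<le> (MAX u. g u) + c"
    by (rule *) (rule assms)
  moreover have "(MAX u. g u) \<le> (MAX u. f u) + c"
    by (rule *) (simp only: abs_minus_commute[of "g _"] assms)
  ultimately show ?thesis by linarith
qed

section \<open>The Bellman operator and the temporal-difference error\<close>

definition bellman ::
  "('s::finite \<Rightarrow> 'a::finite \<Rightarrow> 's pmf) \<Rightarrow> ('s \<Rightarrow> 'a \<Rightarrow> 's \<Rightarrow> real) \<Rightarrow> real \<Rightarrow> real ^ ('s \<times> 'a) \<Rightarrow> 's \<times> 'a \<Rightarrow> real"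
  where
  "bellman P r \<gamma> Q i = (\<Sum>s'\<in>UNIV. pmf (P (fst i) (snd i)) s' *
    (r (fst i) (snd i) s' + \<gamma> * (MAX u. Q $ (s', u))))"

lemma bellman_contraction:
  assumes "0 \<le> \<gamma>"
  shows "\<bar>bellman P r \<gamma> Q i - bellman P r \<gamma> Q' i\<bar> \<le> \<gamma> * infnorm (Q - Q')"
proof -
  let ?m = "\<lambda>Q s'. MAX u. Q $ (s', u)"
  have "bellman P r \<gamma> Q i - bellman P r \<gamma> Q' i
      = (\<Sum>s'\<in>UNIV. pmf (P (fst i) (snd i)) s' * (\<gamma> * (?m Q s' - ?m Q' s')))"
    by (simp add: bellman_def sum_subtractf sum.distrib right_diff_distrib distrib_left)
  also have "\<bar>\<dots>\<bar> \<le> \<gamma> * infnorm (Q - Q')"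
  proof (rule abs_pmf_average_le)
    fix s'
    have "\<bar>?m Q s' - ?m Q' s'\<bar> \<le> infnorm (Q - Q')"
      using component_le_infnorm_cart[of "Q - Q'"] by (intro abs_Max_diff_le) simp
    then show "\<bar>\<gamma> * (?m Q s' - ?m Q' s')\<bar> \<le> \<gamma> * infnorm (Q - Q')"
      using assms by (simp add: abs_mult mult_left_mono)
  qed
  finally show ?thesis .
qed

text \<open>
  The temporal-difference error is taken to vanish at the pairs \<open>i\<close> that are not sampled, so that
  a single formula describes the update of every coordinate.
\<close>

definition td_error ::
  "('s::finite \<Rightarrow> 'a::finite \<Rightarrow> 's \<Rightarrow> real) \<Rightarrow> real \<Rightarrow> real ^ ('s \<times> 'a) \<Rightarrow> 's \<times> 'a \<Rightarrow> 's \<times> 'a \<times> 's \<Rightarrow> real"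
  where
  "td_error r \<gamma> Q i = (\<lambda>(s, a, s'). if i = (s, a) then r s a s' + \<gamma> * (MAX u. Q $ (s', u)) - Q $ i else 0)"

lemma q_update_td_error: "q_update r \<gamma> \<alpha> x Q $ i = Q $ i + \<alpha> * td_error r \<gamma> Q i x"
  by (simp add: q_update_def td_error_def split: prod.split)

lemma sum_sample_pmf:
  fixes P :: "'s::finite \<Rightarrow> 'a::finite \<Rightarrow> 's pmf" and g :: "'s \<times> 'a \<times> 's \<Rightarrow> real"
  shows "(\<Sum>x\<in>UNIV. pmf (sample_pmf P p \<beta>) x * g x)
    = (\<Sum>j\<in>UNIV. sa_dist p \<beta> j * (\<Sum>s'\<in>UNIV. pmf (P (fst j) (snd j)) s' * g (fst j, snd j, s')))"
proof -
  have "(\<Sum>x\<in>UNIV. pmf (sample_pmf P p \<beta>) x * g x) = measure_pmf.expectation (sample_pmf P p \<beta>) g"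
    by (rule expectation_finite[symmetric])
  also have "\<dots> = (\<Sum>s\<in>UNIV. \<Sum>a\<in>UNIV. sa_dist p \<beta> (s, a) * (\<Sum>s'\<in>UNIV. pmf (P s a) s' * g (s, a, s')))"
    unfolding sample_pmf_def expectation_bind_finite
    by (simp add: sa_dist_def sum_distrib_left mult.assoc)
  also have "\<dots> = (\<Sum>j\<in>UNIV. sa_dist p \<beta> j * (\<Sum>s'\<in>UNIV. pmf (P (fst j) (snd j)) s' * g (fst j, snd j, s')))"
    by (simp add: sum.cartesian_product case_prod_beta)
  finally show ?thesis .
qed

lemma sum_sample_pmf_single:
  fixes P :: "'s::finite \<Rightarrow> 'a::finite \<Rightarrow> 's pmf" and g :: "'s \<times> 'a \<times> 's \<Rightarrow> real"
  assumes "\<And>s a s'. (s, a) \<noteq> i \<Longrightarrow> g (s, a, s') = 0"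
  shows "(\<Sum>x\<in>UNIV. pmf (sample_pmf P p \<beta>) x * g x)
    = sa_dist p \<beta> i * (\<Sum>s'\<in>UNIV. pmf (P (fst i) (snd i)) s' * g (fst i, snd i, s'))"
proof -
  have "(\<Sum>x\<in>UNIV. pmf (sample_pmf P p \<beta>) x * g x)
      = (\<Sum>j\<in>{i}. sa_dist p \<beta> j * (\<Sum>s'\<in>UNIV. pmf (P (fst j) (snd j)) s' * g (fst j, snd j, s')))"
    unfolding sum_sample_pmf by (rule sum.mono_neutral_right) (auto simp: assms)
  then show ?thesis by simp
qed

text \<open>
  Coordinate \<open>i\<close> is hit with probability \<open>d(i)\<close>, and given that, the target \<open>r + \<gamma> max Q\<close> averages to the
  Bellman operator.
\<close>

lemma td_error_mean:
  "(\<Sum>x\<in>UNIV. pmf (sample_pmf P p \<beta>) x * td_error r \<gamma> Q i x)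
    = sa_dist p \<beta> i * (bellman P r \<gamma> Q i - Q $ i)"
proof -
  have "(\<Sum>s'\<in>UNIV. pmf (P (fst i) (snd i)) s' * td_error r \<gamma> Q i (fst i, snd i, s'))
      = bellman P r \<gamma> Q i - (\<Sum>s'\<in>UNIV. pmf (P (fst i) (snd i)) s') * Q $ i"
    by (simp add: td_error_def bellman_def sum_subtractf right_diff_distrib sum_distrib_right)
  then have "(\<Sum>s'\<in>UNIV. pmf (P (fst i) (snd i)) s' * td_error r \<gamma> Q i (fst i, snd i, s'))
      = bellman P r \<gamma> Q i - Q $ i"
    by (simp add: sum_pmf_eq_1)
  then show ?thesis
    by (subst sum_sample_pmf_single[of i]) (auto simp: td_error_def)
qed

lemma td_error_measurable:
  assumes "f \<in> borel_measurable N"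
  shows "(\<lambda>\<omega>. td_error r \<gamma> (f \<omega>) i x) \<in> borel_measurable N"
proof -
  obtain s a s' where x: "x = (s, a, s')" by (cases x)
  have "(\<lambda>\<omega>. r s a s' + \<gamma> * (MAX u. f \<omega> $ (s', u)) - f \<omega> $ i) \<in> borel_measurable N"
    by (intro borel_measurable_add borel_measurable_diff borel_measurable_times borel_measurable_const
        borel_measurable_Max borel_measurable_nth_cart assms finite)
  then show ?thesis
    by (simp add: td_error_def x)
qed

lemma bellman_measurable:
  assumes "f \<in> borel_measurable N"
  shows "(\<lambda>\<omega>. bellman P r \<gamma> (f \<omega>) i) \<in> borel_measurable N"
  unfolding bellman_def
  by (intro borel_measurable_sum borel_measurable_add borel_measurable_times borel_measurable_const
      borel_measurable_Max borel_measurable_nth_cart assms finite)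

text \<open>
  Samples take finitely many values, so a sample may be treated as a constant in questions of
  measurability.
\<close>

lemma measurable_finite_index:
  fixes g :: "'w \<Rightarrow> 'x::finite"
  assumes "\<And>x. f x \<in> borel_measurable N" and "g \<in> measurable N (count_space UNIV)"
  shows "(\<lambda>\<omega>. f (g \<omega>) \<omega>) \<in> borel_measurable N"
  using assms by (rule measurable_compose_countable'[where I = UNIV]) simp_all

lemma q_iterate_measurable:
  fixes X :: "nat \<Rightarrow> 'w \<Rightarrow> 's::finite \<times> 'a::finite \<times> 's"
  assumes "Q0 \<in> borel_measurable N" and "\<And>j. j < k \<Longrightarrow> X j \<in> measurable N (count_space UNIV)"
  shows "q_iterate r \<gamma> \<alpha> Q0 X k \<in> borel_measurable N"
  using assms(2)
proof (induction k)
  case 0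
  then show ?case using assms(1) by (simp add: fun_eq_iff[symmetric])
next
  case (Suc k)
  then have IH: "q_iterate r \<gamma> \<alpha> Q0 X k \<in> borel_measurable N" by simp
  have "(\<lambda>\<omega>. td_error r \<gamma> (q_iterate r \<gamma> \<alpha> Q0 X k \<omega>) i (X k \<omega>)) \<in> borel_measurable N" for i
    by (rule measurable_finite_index[where f = "\<lambda>x \<omega>. td_error r \<gamma> (q_iterate r \<gamma> \<alpha> Q0 X k \<omega>) i x"])
       (simp_all add: td_error_measurable[OF IH] Suc.prems)
  then have "(\<lambda>\<omega>. q_iterate r \<gamma> \<alpha> Q0 X k \<omega> $ i
      + \<alpha> * td_error r \<gamma> (q_iterate r \<gamma> \<alpha> Q0 X k \<omega>) i (X k \<omega>)) \<in> borel_measurable N" for i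
    by (intro borel_measurable_add borel_measurable_times borel_measurable_const borel_measurable_nth_cart IH)
  then show ?case
    by (intro borel_measurable_cart) (simp add: q_update_td_error)
qed

section \<open>Decomposition of the error\<close>

text \<open>
  Policies are abstracted away: \<open>Q_opt\<close> is a fixed point of the Bellman operator, and \<open>d_min\<close> and
  \<open>d_max\<close> enclose the sampling probabilities.
\<close>

locale async_q_learning = prob_space M for M :: "'w measure" +
  fixes P :: "'s::finite \<Rightarrow> 'a::finite \<Rightarrow> 's pmf"
    and r :: "'s \<Rightarrow> 'a \<Rightarrow> 's \<Rightarrow> real"
    and \<gamma> \<alpha> d_max d_min :: real
    and p :: "'s pmf"
    and \<beta> :: "'s \<Rightarrow> 'a pmf"
    and Q0 :: "'w \<Rightarrow> real ^ ('s \<times> 'a)"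
    and X :: "nat \<Rightarrow> 'w \<Rightarrow> 's \<times> 'a \<times> 's"
    and Q_opt :: "real ^ ('s \<times> 'a)"
  assumes \<gamma>: "0 \<le> \<gamma>" "\<gamma> < 1"
    and \<alpha>: "0 < \<alpha>" "\<alpha> < 1"
    and reward: "\<And>s a s'. \<bar>r s a s'\<bar> \<le> 1"
    and Q0_measurable: "Q0 \<in> borel_measurable M"
    and Q0_bound: "AE \<omega> in M. infnorm (Q0 \<omega>) \<le> 1"
    and iid: "iid_sampling M P p \<beta> Q0 X"
    and d_min: "0 < d_min" "\<And>i. d_min \<le> sa_dist p \<beta> i"
    and d_max: "\<And>i. sa_dist p \<beta> i \<le> d_max"
    and fixed_point: "\<And>i. bellman P r \<gamma> Q_opt i = Q_opt $ i"
begin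

abbreviation d :: "'s \<times> 'a \<Rightarrow> real" where "d \<equiv> sa_dist p \<beta>"

abbreviation Q :: "nat \<Rightarrow> 'w \<Rightarrow> real ^ ('s \<times> 'a)" where "Q \<equiv> q_iterate r \<gamma> \<alpha> Q0 X"

text \<open>
  The part of the error driven by the initial error and by the fluctuation of the temporal-difference
  error around its conditional mean.
\<close>

primrec noise :: "nat \<Rightarrow> 'w \<Rightarrow> real ^ ('s \<times> 'a)" where
  "noise 0 \<omega> = Q0 \<omega> - Q_opt"
| "noise (Suc k) \<omega> = (\<chi> i. (1 - \<alpha> * d i) * noise k \<omega> $ i
    + \<alpha> * (td_error r \<gamma> (Q k \<omega>) i (X k \<omega>) - d i * (bellman P r \<gamma> (Q k \<omega>) i - Q k \<omega> $ i)))"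

definition drift :: "nat \<Rightarrow> 'w \<Rightarrow> real ^ ('s \<times> 'a)" where
  "drift k \<omega> = Q k \<omega> - Q_opt - noise k \<omega>"

lemma d_pos: "0 < d i"
  using d_min(1) d_min(2)[of i] by linarith

lemma d_le_1: "d i \<le> 1"
  by (cases i) (simp add: sa_dist_def mult_le_one pmf_le_1)

lemma \<alpha>_d: "0 \<le> \<alpha> * d i" "\<alpha> * d i \<le> 1"
  using \<alpha> d_pos[of i] d_le_1[of i] mult_le_one[of \<alpha> "d i"] by simp_all

lemma drift_0: "drift 0 \<omega> = 0"
  by (simp add: drift_def)

text \<open>
  The fluctuations cancel in the difference of error and noise, leaving a recursion driven by the
  Bellman operator alone.
\<close>

lemma drift_Suc:
  "drift (Suc k) \<omega> $ i = (1 - \<alpha> * d i) * drift k \<omega> $ i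
    + \<alpha> * d i * (bellman P r \<gamma> (Q k \<omega>) i - bellman P r \<gamma> Q_opt i)"
  by (simp add: drift_def q_update_td_error fixed_point algebra_simps)

text \<open>
  The error is the sum of noise and drift, so the contraction property of the Bellman operator gives
  a factor \<open>1 - \<alpha> d(i) (1 - \<gamma>)\<close> for the drift in coordinate \<open>i\<close>, at the price of a term in the noise.
\<close>

lemma infnorm_drift_Suc:
  "infnorm (drift (Suc k) \<omega>) \<le> (1 - \<alpha> * d_min * (1 - \<gamma>)) * infnorm (drift k \<omega>)
    + \<alpha> * \<gamma> * d_max * infnorm (noise k \<omega>)"
proof (rule infnorm_le_cart)
  fix i
  let ?u = "infnorm (drift k \<omega>)" and ?y = "infnorm (noise k \<omega>)"
  have nonneg: "0 \<le> ?u" "0 \<le> ?y"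
    by (simp_all add: infnorm_pos_le)
  have "infnorm (Q k \<omega> - Q_opt) \<le> ?u + ?y"
    using infnorm_triangle[of "drift k \<omega>" "noise k \<omega>"] by (simp add: drift_def)
  then have "\<bar>bellman P r \<gamma> (Q k \<omega>) i - bellman P r \<gamma> Q_opt i\<bar> \<le> \<gamma> * (?u + ?y)"
    by (rule order_trans[OF bellman_contraction[OF \<gamma>(1)] mult_left_mono[OF _ \<gamma>(1)]])
  then have "\<bar>\<alpha> * d i * (bellman P r \<gamma> (Q k \<omega>) i - bellman P r \<gamma> Q_opt i)\<bar>
      \<le> \<alpha> * d i * (\<gamma> * (?u + ?y))"
    unfolding abs_mult[of "\<alpha> * d i"] abs_of_nonneg[OF \<alpha>_d(1)] by (rule mult_left_mono[OF _ \<alpha>_d(1)])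
  moreover have "\<bar>(1 - \<alpha> * d i) * drift k \<omega> $ i\<bar> \<le> (1 - \<alpha> * d i) * ?u"
    using \<alpha>_d[of i] component_le_infnorm_cart[of "drift k \<omega>" i]
    by (simp add: abs_mult mult_left_mono)
  ultimately have "\<bar>drift (Suc k) \<omega> $ i\<bar> \<le> (1 - \<alpha> * d i) * ?u + \<alpha> * d i * (\<gamma> * (?u + ?y))"
    unfolding drift_Suc by linarith
  \<comment> \<open>Isolating \<open>d i\<close> shows the signs with which it enters: \<open>d_min\<close> bounds one term, \<open>d_max\<close> the other.\<close>
  also have "\<dots> = ?u - d i * (\<alpha> * (1 - \<gamma>) * ?u) + d i * (\<alpha> * \<gamma> * ?y)"
    by (simp add: algebra_simps)
  also have "\<dots> \<le> ?u - d_min * (\<alpha> * (1 - \<gamma>) * ?u) + d_max * (\<alpha> * \<gamma> * ?y)"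
    using \<alpha> \<gamma> nonneg d_min(2)[of i] d_max[of i]
    by (intro add_mono diff_mono order_refl mult_right_mono) simp_all
  also have "\<dots> = (1 - \<alpha> * d_min * (1 - \<gamma>)) * ?u + \<alpha> * \<gamma> * d_max * ?y"
    by (simp add: algebra_simps)
  finally show "\<bar>drift (Suc k) \<omega> $ i\<bar> \<le> \<dots>" .
qed

lemma sum_drift_le_sum_noise:
  "(\<Sum>k<N. infnorm (drift k \<omega>)) \<le> \<gamma> * d_max / (d_min * (1 - \<gamma>)) * (\<Sum>k<N. infnorm (noise k \<omega>))"
proof -
  have "\<alpha> * d_min * (1 - \<gamma>) * (\<Sum>k<N. infnorm (drift k \<omega>))
      \<le> infnorm (drift 0 \<omega>) + (\<Sum>k<N. \<alpha> * \<gamma> * d_max * infnorm (noise k \<omega>))"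
    by (rule contraction_sum_bound) (simp_all only: infnorm_drift_Suc infnorm_pos_le)
  then have "\<alpha> * (d_min * (1 - \<gamma>) * (\<Sum>k<N. infnorm (drift k \<omega>)))
      \<le> \<alpha> * (\<gamma> * d_max * (\<Sum>k<N. infnorm (noise k \<omega>)))"
    by (simp add: drift_0 infnorm_0 sum_distrib_left[symmetric] mult.assoc)
  then have "d_min * (1 - \<gamma>) * (\<Sum>k<N. infnorm (drift k \<omega>)) \<le> \<gamma> * d_max * (\<Sum>k<N. infnorm (noise k \<omega>))"
    using \<alpha> by simp
  then show ?thesis
    using d_min(1) \<gamma> by (simp add: pos_le_divide_eq mult.commute)
qed

section \<open>Almost sure bounds and measurability\<close>

lemma target_bound:
  assumes "\<And>j. \<bar>q $ j\<bar> \<le> C"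
  shows "\<bar>r s a s' + \<gamma> * (MAX u. q $ (s', u))\<bar> \<le> 1 + \<gamma> * C"
proof -
  have "\<bar>MAX u. q $ (s', u)\<bar> \<le> C"
    using abs_Max_diff_le[of "\<lambda>u. q $ (s', u)" "\<lambda>_. 0" C] assms by simp
  then have "\<bar>\<gamma> * (MAX u. q $ (s', u))\<bar> \<le> \<gamma> * C"
    using \<gamma>(1) by (simp add: abs_mult mult_left_mono)
  then show ?thesis
    using reward[of s a s'] by linarith
qed

lemma bellman_bound:
  assumes "\<And>j. \<bar>q $ j\<bar> \<le> C"
  shows "\<bar>bellman P r \<gamma> q i\<bar> \<le> 1 + \<gamma> * C"
  unfolding bellman_def by (rule abs_pmf_average_le) (rule target_bound[OF assms])

text \<open>
  The fixed-point equation bounds the norm of \<open>Q_opt\<close> by \<open>1 + \<gamma>\<close> times itself.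
\<close>

lemma Q_opt_bound: "\<bar>Q_opt $ i\<bar> \<le> 1 / (1 - \<gamma>)"
proof -
  have "\<bar>Q_opt $ j\<bar> \<le> 1 + \<gamma> * infnorm Q_opt" for j
    using bellman_bound[of Q_opt, OF component_le_infnorm_cart, of j] by (simp add: fixed_point)
  then have "infnorm Q_opt \<le> 1 + \<gamma> * infnorm Q_opt"
    by (rule infnorm_le_cart)
  then have "infnorm Q_opt \<le> 1 / (1 - \<gamma>)"
    using \<gamma> by (simp add: field_simps)
  then show ?thesis
    using component_le_infnorm_cart[of Q_opt i] by linarith
qed

lemma fixed_bound_eq: "1 + \<gamma> * (1 / (1 - \<gamma>)) = 1 / (1 - \<gamma>)"
  using \<gamma> by (simp add: field_simps)

lemma bellman_Q_bound:
  assumes "\<And>j. \<bar>q $ j\<bar> \<le> 1 / (1 - \<gamma>)"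
  shows "\<bar>bellman P r \<gamma> q i\<bar> \<le> 1 / (1 - \<gamma>)"
  using bellman_bound[OF assms] by (simp only: fixed_bound_eq)

lemma td_error_bound:
  assumes "\<And>j. \<bar>q $ j\<bar> \<le> 1 / (1 - \<gamma>)"
  shows "\<bar>td_error r \<gamma> q i x\<bar> \<le> 2 / (1 - \<gamma>)"
proof -
  obtain s a s' where x: "x = (s, a, s')" by (cases x)
  have "\<bar>r s a s' + \<gamma> * (MAX u. q $ (s', u)) - q $ i\<bar> \<le> 1 / (1 - \<gamma>) + 1 / (1 - \<gamma>)"
    using target_bound[OF assms, of s a s'] assms[of i] unfolding fixed_bound_eq by linarith
  then show ?thesis
    using \<gamma> by (auto simp: td_error_def x)
qed

text \<open>
  An update is a convex combination of the old entry and the target \<open>r + \<gamma> max Q\<close>, and the interval of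
  radius \<open>1 / (1 - \<gamma>)\<close> is invariant under forming targets.
\<close>

lemma Q_bound:
  assumes "infnorm (Q0 \<omega>) \<le> 1"
  shows "\<bar>Q k \<omega> $ i\<bar> \<le> 1 / (1 - \<gamma>)"
proof (induction k arbitrary: i)
  case 0
  have "1 \<le> 1 / (1 - \<gamma>)" using \<gamma> by simp
  then show ?case
    using assms component_le_infnorm_cart[of "Q0 \<omega>" i] by simp
next
  case (Suc k)
  obtain s a s' where x: "X k \<omega> = (s, a, s')" by (cases "X k \<omega>")
  show ?case
  proof (cases "i = (s, a)")
    case True
    have "\<bar>(1 - \<alpha>) * Q k \<omega> $ i + \<alpha> * (r s a s' + \<gamma> * (MAX u. Q k \<omega> $ (s', u)))\<bar>
        \<le> (1 - \<alpha>) * (1 / (1 - \<gamma>)) + \<alpha> * (1 / (1 - \<gamma>))"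
    proof (rule order_trans[OF abs_triangle_ineq add_mono])
      show "\<bar>(1 - \<alpha>) * Q k \<omega> $ i\<bar> \<le> (1 - \<alpha>) * (1 / (1 - \<gamma>))"
        using \<alpha> mult_left_mono[OF Suc.IH[of i], of "1 - \<alpha>"] by (simp add: abs_mult)
      show "\<bar>\<alpha> * (r s a s' + \<gamma> * (MAX u. Q k \<omega> $ (s', u)))\<bar> \<le> \<alpha> * (1 / (1 - \<gamma>))"
        using \<alpha> mult_left_mono[OF target_bound[OF Suc.IH, of s a s'], of \<alpha>]
        unfolding fixed_bound_eq by (simp add: abs_mult)
    qed
    also have "\<dots> = 1 / (1 - \<gamma>)"
      by (simp add: add_divide_distrib[symmetric])
    finally show ?thesis
      by (simp add: True q_update_def x algebra_simps)
  next
    case False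
    then show ?thesis
      using Suc.IH[of i] by (simp add: q_update_def x)
  qed
qed

lemma centred_td_error_bound:
  assumes "\<And>j. \<bar>q $ j\<bar> \<le> 1 / (1 - \<gamma>)"
  shows "\<bar>td_error r \<gamma> q i x - d i * (bellman P r \<gamma> q i - q $ i)\<bar> \<le> 4 / (1 - \<gamma>)"
proof -
  have "\<bar>d i * (bellman P r \<gamma> q i - q $ i)\<bar> \<le> 1 * (1 / (1 - \<gamma>) + 1 / (1 - \<gamma>))"
    unfolding abs_mult using d_pos[of i] d_le_1[of i] bellman_Q_bound[OF assms, of i] assms[of i]
    by (intro mult_mono) auto
  then show ?thesis
    using td_error_bound[OF assms, of i x] by simp
qed

lemma noise_step_bound:
  assumes "\<bar>y\<bar> \<le> C" and "\<And>j. \<bar>q $ j\<bar> \<le> 1 / (1 - \<gamma>)"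
  shows "\<bar>(1 - \<alpha> * d i) * y
    + \<alpha> * (td_error r \<gamma> q i x - d i * (bellman P r \<gamma> q i - q $ i))\<bar> \<le> C + 4 / (1 - \<gamma>)"
proof -
  have "\<bar>(1 - \<alpha> * d i) * y\<bar> \<le> 1 * C"
    unfolding abs_mult using \<alpha>_d[of i] assms(1) by (intro mult_mono) auto
  moreover have "\<bar>\<alpha> * (td_error r \<gamma> q i x - d i * (bellman P r \<gamma> q i - q $ i))\<bar> \<le> 1 * (4 / (1 - \<gamma>))"
    unfolding abs_mult using \<alpha> centred_td_error_bound[OF assms(2)] by (intro mult_mono) auto
  ultimately show ?thesis by linarith
qed

lemma initial_noise_bound:
  assumes "infnorm (Q0 \<omega>) \<le> 1"
  shows "\<bar>noise 0 \<omega> $ i\<bar> \<le> 2 / (1 - \<gamma>)"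
  using Q_bound[OF assms, of 0 i] Q_opt_bound[of i] by simp

text \<open>
  A crude bound that grows with \<open>k\<close>; it only serves to make the second moments finite.
\<close>

lemma noise_bound:
  assumes "infnorm (Q0 \<omega>) \<le> 1"
  shows "\<bar>noise k \<omega> $ i\<bar> \<le> 2 / (1 - \<gamma>) + real k * (4 / (1 - \<gamma>))"
proof (induction k arbitrary: i)
  case 0
  show ?case using initial_noise_bound[OF assms, of i] by simp
next
  case (Suc k)
  show ?case
    using noise_step_bound[OF Suc.IH[of i] Q_bound[OF assms], of i k "X k \<omega>"] by (simp add: algebra_simps add_divide_distrib)
qed

text \<open>
  Stated for an arbitrary \<open>\<sigma>\<close>-algebra, since it is used both for \<open>M\<close> and for the past.
\<close>

lemma noise_measurable:
  assumes "Q0 \<in> borel_measurable N" and "\<And>j. j < k \<Longrightarrow> X j \<in> measurable N (count_space UNIV)"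
  shows "noise k \<in> borel_measurable N"
  using assms(2)
proof (induction k)
  case 0
  have "(\<lambda>\<omega>. Q0 \<omega> - Q_opt) \<in> borel_measurable N"
    using assms(1) by simp
  then show ?case by simp
next
  case (Suc k)
  have Qk: "Q k \<in> borel_measurable N"
    using assms(1) Suc.prems by (intro q_iterate_measurable) auto
  have IH: "noise k \<in> borel_measurable N" using Suc by simp
  have "(\<lambda>\<omega>. td_error r \<gamma> (Q k \<omega>) i (X k \<omega>)) \<in> borel_measurable N" for i
    by (rule measurable_finite_index[where f = "\<lambda>x \<omega>. td_error r \<gamma> (Q k \<omega>) i x"])
       (simp_all add: td_error_measurable[OF Qk] Suc.prems)
  then have "(\<lambda>\<omega>. (1 - \<alpha> * d i) * noise k \<omega> $ i
    + \<alpha> * (td_error r \<gamma> (Q k \<omega>) i (X k \<omega>) - d i * (bellman P r \<gamma> (Q k \<omega>) i - Q k \<omega> $ i)))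
    \<in> borel_measurable N" for i
    by (intro borel_measurable_add borel_measurable_diff borel_measurable_times borel_measurable_const
        borel_measurable_nth_cart IH Qk bellman_measurable)
  then show ?case
    by (intro borel_measurable_cart) simp
qed

end

context async_q_learning
begin

section \<open>Conditioning on the past\<close>

definition past :: "nat \<Rightarrow> 'w measure" where
  "past k = vimage_algebra (space M) (\<lambda>\<omega>. (Q0 \<omega>, \<lambda>i\<in>{..<k}. X i \<omega>))
    (borel \<Otimes>\<^sub>M PiM {..<k} (\<lambda>_. count_space UNIV))"

lemma X_measurable: "X k \<in> measurable M (count_space UNIV)"
  using iid by (simp add: iid_sampling_def)

lemma distr_X: "distr M (count_space UNIV) (X k) = measure_pmf (sample_pmf P p \<beta>)"
  using iid by (simp add: iid_sampling_def)

lemma past_indep_X: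
  "indep_set (sets (past k)) (sets (vimage_algebra (space M) (X k) (count_space UNIV)))"
  using iid by (simp add: iid_sampling_def past_def)

lemma space_past: "space (past k) = space M"
  by (simp add: past_def)

lemma past_subalgebra: "subalgebra M (past k)"
  using indep_setD_ev1[OF past_indep_X] by (simp add: subalgebra_def space_past)

lemma history_past:
  "(\<lambda>\<omega>. (Q0 \<omega>, \<lambda>i\<in>{..<k}. X i \<omega>))
    \<in> measurable (past k) (borel \<Otimes>\<^sub>M PiM {..<k} (\<lambda>_. count_space UNIV))"
  unfolding past_def by (rule measurable_vimage_algebra1) (auto simp: space_pair_measure space_PiM)

lemma Q0_past: "Q0 \<in> borel_measurable (past k)"
  using measurable_compose[OF history_past measurable_fst] by simp

lemma X_past:
  assumes "j < k"
  shows "X j \<in> measurable (past k) (count_space UNIV)"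
proof -
  have "(\<lambda>f. f j) \<in> measurable (PiM {..<k} (\<lambda>_. count_space (UNIV :: ('s \<times> 'a \<times> 's) set))) (count_space UNIV)"
    using assms by (intro measurable_component_singleton) simp
  from measurable_compose[OF measurable_compose[OF history_past measurable_snd] this] show ?thesis
    using assms by simp
qed

lemma Q_past: "Q k \<in> borel_measurable (past k)"
  by (rule q_iterate_measurable) (rule Q0_past, rule X_past)

lemma noise_past: "noise k \<in> borel_measurable (past k)"
  by (rule noise_measurable) (rule Q0_past, rule X_past)

lemma past_indep_indicator:
  assumes "f \<in> borel_measurable (past k)"
  shows "indep_var borel f borel (\<lambda>\<omega>. indicator {x} (X k \<omega>) :: real)"
proof -
  let ?g = "\<lambda>\<omega>. indicator {x} (X k \<omega>) :: real"
  let ?V = "vimage_algebra (space M) (X k) (count_space UNIV)"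
  have g: "?g \<in> borel_measurable ?V"
    by (rule measurable_compose[OF measurable_vimage_algebra1]) auto
  have gen: "sigma_sets (space M) {h -` A \<inter> space M |A. A \<in> sets borel} \<subseteq> sets N"
    if "h \<in> borel_measurable N" "space N = space M" for h :: "'w \<Rightarrow> real" and N
    using measurable_sets[OF that(1)] unfolding that(2)[symmetric] by (intro sets.sigma_sets_subset) auto
  have "indep_set (sigma_sets (space M) {f -` A \<inter> space M |A. A \<in> sets borel})
      (sigma_sets (space M) {?g -` A \<inter> space M |A. A \<in> sets borel})"
    using gen[OF assms space_past] gen[OF g]
    unfolding indep_set_def
    by (intro indep_sets_mono_sets[OF past_indep_X[of k, unfolded indep_set_def]]) (auto split: bool.split)
  moreover have "f \<in> borel_measurable M"
    by (rule measurable_from_subalg[OF past_subalgebra assms])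
  moreover have "?g \<in> borel_measurable M"
    by (rule measurable_compose[OF X_measurable]) simp
  ultimately show ?thesis
    by (simp add: indep_var_eq)
qed

lemma expectation_X_indicator: "expectation (\<lambda>\<omega>. indicator {x} (X k \<omega>)) = pmf (sample_pmf P p \<beta>) x"
proof -
  have "expectation (\<lambda>\<omega>. indicator {x} (X k \<omega>) :: real)
      = (\<integral>z. indicator {x} z \<partial>distr M (count_space UNIV) (X k))"
    by (rule integral_distr[symmetric, OF X_measurable]) simp
  also have "\<dots> = pmf (sample_pmf P p \<beta>) x"
    by (simp add: distr_X measure_pmf_single)
  finally show ?thesis .
qed

text \<open>
  The sample \<open>X k\<close> may be averaged out as if the past were fixed. Since it takes finitely many values,
  this needs no conditional expectations: \<open>h (X k)\<close> is a finite sum of past quantities times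
  indicators of \<open>X k\<close>, and each product is one of independent variables.
\<close>

lemma
  assumes meas: "\<And>x. h x \<in> borel_measurable (past k)"
    and bound: "\<And>x. AE \<omega> in M. \<bar>h x \<omega>\<bar> \<le> C"
  shows integrable_past: "integrable M (h x)"
    and expectation_past_sample: "expectation (\<lambda>\<omega>. h (X k \<omega>) \<omega>)
      = expectation (\<lambda>\<omega>. \<Sum>x\<in>UNIV. pmf (sample_pmf P p \<beta>) x * h x \<omega>)"
proof -
  have int: "integrable M (h x)" for x
    using bound[of x] measurable_from_subalg[OF past_subalgebra meas]
    by (intro integrable_const_bound[where B = C]) auto
  then show "integrable M (h x)" .
  have ind: "integrable M (\<lambda>\<omega>. indicator {x} (X k \<omega>) :: real)" for x
    by (intro integrable_const_bound[where B = 1] measurable_compose[OF X_measurable])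
       (auto simp: indicator_def)
  have split: "(\<lambda>\<omega>. h (X k \<omega>) \<omega>) = (\<lambda>\<omega>. \<Sum>x\<in>UNIV. h x \<omega> * indicator {x} (X k \<omega>))"
    by (simp add: fun_eq_iff indicator_def if_distrib sum.delta cong: if_cong)
  have "expectation (\<lambda>\<omega>. h (X k \<omega>) \<omega>) = (\<Sum>x\<in>UNIV. expectation (\<lambda>\<omega>. h x \<omega> * indicator {x} (X k \<omega>)))"
    unfolding split
    by (intro Bochner_Integration.integral_sum indep_var_integrable past_indep_indicator meas int ind)
  also have "\<dots> = (\<Sum>x\<in>UNIV. expectation (h x) * pmf (sample_pmf P p \<beta>) x)"
    by (intro sum.cong refl)
       (simp only: indep_var_lebesgue_integral[OF past_indep_indicator[OF meas] int ind] expectation_X_indicator)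
  also have "\<dots> = expectation (\<lambda>\<omega>. \<Sum>x\<in>UNIV. pmf (sample_pmf P p \<beta>) x * h x \<omega>)"
    by (subst Bochner_Integration.integral_sum) (simp_all add: int mult.commute)
  finally show "expectation (\<lambda>\<omega>. h (X k \<omega>) \<omega>)
      = expectation (\<lambda>\<omega>. \<Sum>x\<in>UNIV. pmf (sample_pmf P p \<beta>) x * h x \<omega>)" .
qed

section \<open>Second moments of the noise\<close>

text \<open>
  The factor \<open>d i\<close>, the probability that coordinate \<open>i\<close> is hit at all, matches the rate \<open>\<alpha> d(i)\<close> at which
  the noise contracts in that coordinate, so that it cancels in the long-run average.
\<close>

lemma td_error_second_moment:
  assumes "\<And>j. \<bar>q $ j\<bar> \<le> 1 / (1 - \<gamma>)"
  shows "(\<Sum>x\<in>UNIV. pmf (sample_pmf P p \<beta>) x * (td_error r \<gamma> q i x)\<^sup>2) \<le> d i * (2 / (1 - \<gamma>))\<^sup>2"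
proof -
  have "(\<Sum>s'\<in>UNIV. pmf (P (fst i) (snd i)) s' * (td_error r \<gamma> q i (fst i, snd i, s'))\<^sup>2) \<le> (2 / (1 - \<gamma>))\<^sup>2"
    using td_error_bound[OF assms, of i] \<gamma> by (intro pmf_average_le abs_le_square_iff[THEN iffD1]) simp
  then show ?thesis
    using d_pos[of i] by (subst sum_sample_pmf_single[of i]) (auto simp: td_error_def mult_left_mono)
qed

lemma noise_integrable: "integrable M (\<lambda>\<omega>. (noise k \<omega> $ i)\<^sup>2)"
proof (rule integrable_const_bound[where B = "(2 / (1 - \<gamma>) + real k * (4 / (1 - \<gamma>)))\<^sup>2"])
  show "AE \<omega> in M. norm ((noise k \<omega> $ i)\<^sup>2) \<le> (2 / (1 - \<gamma>) + real k * (4 / (1 - \<gamma>)))\<^sup>2"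
    using Q0_bound
  proof eventually_elim
    case (elim \<omega>)
    then show ?case
      using power_mono[OF noise_bound[OF elim, of k i], of 2] by simp
  qed
  show "(\<lambda>\<omega>. (noise k \<omega> $ i)\<^sup>2) \<in> borel_measurable M"
    by (intro borel_measurable_power borel_measurable_nth_cart noise_measurable Q0_measurable X_measurable)
qed

text \<open>
  Averaging over the sample \<open>X k\<close> with the past fixed removes the cross term.
\<close>

lemma noise_second_moment_Suc:
  "expectation (\<lambda>\<omega>. (noise (Suc k) \<omega> $ i)\<^sup>2)
    \<le> (1 - \<alpha> * d i) * expectation (\<lambda>\<omega>. (noise k \<omega> $ i)\<^sup>2) + \<alpha>\<^sup>2 * d i * (2 / (1 - \<gamma>))\<^sup>2"
proof -
  \<comment> \<open>The squared noise after the step, as a function of the sample \<open>x\<close> and the past.\<close>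
  define h where "h x \<omega> = ((1 - \<alpha> * d i) * noise k \<omega> $ i
      + \<alpha> * (td_error r \<gamma> (Q k \<omega>) i x - d i * (bellman P r \<gamma> (Q k \<omega>) i - Q k \<omega> $ i)))\<^sup>2" for x \<omega>
  let ?C = "2 / (1 - \<gamma>) + real k * (4 / (1 - \<gamma>)) + 4 / (1 - \<gamma>)"
  have h_meas: "h x \<in> borel_measurable (past k)" for x
    unfolding h_def
    by (intro borel_measurable_power borel_measurable_add borel_measurable_diff borel_measurable_times
        borel_measurable_const borel_measurable_nth_cart noise_past Q_past bellman_measurable td_error_measurable)
  have h_bound: "AE \<omega> in M. \<bar>h x \<omega>\<bar> \<le> ?C\<^sup>2" for x
    using Q0_bound
  proof eventually_elim
    case (elim \<omega>)
    show ?case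
      using power_mono[OF noise_step_bound[OF noise_bound[OF elim, of k i] Q_bound[OF elim], of i k x], of 2]
      by (simp add: h_def)
  qed
  have "expectation (\<lambda>\<omega>. (noise (Suc k) \<omega> $ i)\<^sup>2) = expectation (\<lambda>\<omega>. h (X k \<omega>) \<omega>)"
    by (simp add: h_def)
  also have "\<dots> = expectation (\<lambda>\<omega>. \<Sum>x\<in>UNIV. pmf (sample_pmf P p \<beta>) x * h x \<omega>)"
    by (rule expectation_past_sample[OF h_meas h_bound])
  also have "\<dots> \<le> expectation (\<lambda>\<omega>. (1 - \<alpha> * d i) * (noise k \<omega> $ i)\<^sup>2 + \<alpha>\<^sup>2 * d i * (2 / (1 - \<gamma>))\<^sup>2)"
  proof (rule integral_mono_AE)
    show "integrable M (\<lambda>\<omega>. \<Sum>x\<in>UNIV. pmf (sample_pmf P p \<beta>) x * h x \<omega>)"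
      by (intro Bochner_Integration.integrable_sum integrable_mult_right
          integrable_past[where h = h and k = k and C = "?C\<^sup>2"] h_meas h_bound)
    show "integrable M (\<lambda>\<omega>. (1 - \<alpha> * d i) * (noise k \<omega> $ i)\<^sup>2 + \<alpha>\<^sup>2 * d i * (2 / (1 - \<gamma>))\<^sup>2)"
      using noise_integrable[of k i] by simp
    show "AE \<omega> in M. (\<Sum>x\<in>UNIV. pmf (sample_pmf P p \<beta>) x * h x \<omega>)
        \<le> (1 - \<alpha> * d i) * (noise k \<omega> $ i)\<^sup>2 + \<alpha>\<^sup>2 * d i * (2 / (1 - \<gamma>))\<^sup>2"
      using Q0_bound
    proof eventually_elim
      case (elim \<omega>)
      have "(\<Sum>x\<in>UNIV. pmf (sample_pmf P p \<beta>) x * h x \<omega>) \<le> ((1 - \<alpha> * d i) * noise k \<omega> $ i)\<^sup>2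
          + \<alpha>\<^sup>2 * (\<Sum>x\<in>UNIV. pmf (sample_pmf P p \<beta>) x * (td_error r \<gamma> (Q k \<omega>) i x)\<^sup>2)"
        unfolding h_def by (rule pmf_centred_second_moment_le[OF td_error_mean])
      also have "\<alpha>\<^sup>2 * (\<Sum>x\<in>UNIV. pmf (sample_pmf P p \<beta>) x * (td_error r \<gamma> (Q k \<omega>) i x)\<^sup>2)
          \<le> \<alpha>\<^sup>2 * (d i * (2 / (1 - \<gamma>))\<^sup>2)"
        by (intro mult_left_mono td_error_second_moment Q_bound elim) simp
      also have "((1 - \<alpha> * d i) * noise k \<omega> $ i)\<^sup>2 \<le> (1 - \<alpha> * d i) * (noise k \<omega> $ i)\<^sup>2"
      proof -
        have "(1 - \<alpha> * d i)\<^sup>2 \<le> 1 - \<alpha> * d i"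
          using \<alpha>_d[of i] by (simp add: power2_eq_square mult_left_le)
        then show ?thesis
          by (simp add: power_mult_distrib mult_right_mono)
      qed
      finally show ?case by (simp add: mult.assoc)
    qed
  qed
  also have "\<dots> = (1 - \<alpha> * d i) * expectation (\<lambda>\<omega>. (noise k \<omega> $ i)\<^sup>2) + \<alpha>\<^sup>2 * d i * (2 / (1 - \<gamma>))\<^sup>2"
    using noise_integrable[of k i] by (simp add: prob_space)
  finally show ?thesis .
qed

lemma sum_noise_second_moment:
  "(\<Sum>k<N. expectation (\<lambda>\<omega>. (noise k \<omega> $ i)\<^sup>2)) \<le> (2 / (1 - \<gamma>))\<^sup>2 / d_min * (real N * \<alpha> + 1 / \<alpha>)"
proof -
  let ?c = "(2 / (1 - \<gamma>))\<^sup>2" and ?S = "\<Sum>k<N. expectation (\<lambda>\<omega>. (noise k \<omega> $ i)\<^sup>2)"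
  have init: "expectation (\<lambda>\<omega>. (noise 0 \<omega> $ i)\<^sup>2) \<le> ?c"
  proof -
    have "expectation (\<lambda>\<omega>. (noise 0 \<omega> $ i)\<^sup>2) \<le> expectation (\<lambda>_. ?c)"
    proof (rule integral_mono_AE)
      show "AE \<omega> in M. (noise 0 \<omega> $ i)\<^sup>2 \<le> ?c"
        using Q0_bound
      proof eventually_elim
        case (elim \<omega>)
        show ?case
          using power_mono[OF initial_noise_bound[OF elim, of i], of 2] by simp
      qed
    qed (rule noise_integrable, simp)
    then show ?thesis by (simp add: prob_space)
  qed
  have "\<alpha> * d i * ?S \<le> expectation (\<lambda>\<omega>. (noise 0 \<omega> $ i)\<^sup>2) + (\<Sum>k<N. \<alpha>\<^sup>2 * d i * ?c)"
    by (rule contraction_sum_bound) (rule noise_second_moment_Suc, simp)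
  also have "\<dots> \<le> ?c + \<alpha> * d i * (real N * \<alpha> * ?c)"
    using init by (simp add: power2_eq_square algebra_simps)
  finally have "?S \<le> (?c + \<alpha> * d i * (real N * \<alpha> * ?c)) / (\<alpha> * d i)"
    using \<alpha> d_pos[of i] by (simp add: pos_le_divide_eq mult.commute)
  also have "\<dots> = ?c / \<alpha> / d i + real N * \<alpha> * ?c"
    using \<alpha> d_pos[of i] by (simp add: field_simps)
  also have "\<dots> \<le> ?c / \<alpha> / d_min + real N * \<alpha> * ?c / d_min"
  proof (intro add_mono)
    show "?c / \<alpha> / d i \<le> ?c / \<alpha> / d_min"
      using \<alpha> d_min by (intro divide_left_mono) (simp_all add: d_pos)
    have "d_min \<le> 1" using d_min(2)[of i] d_le_1[of i] by linarith
    then have "real N * \<alpha> * ?c * d_min \<le> real N * \<alpha> * ?c * 1"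
      using \<alpha> by (intro mult_left_mono) simp_all
    then show "real N * \<alpha> * ?c \<le> real N * \<alpha> * ?c / d_min"
      using d_min(1) by (simp add: pos_le_divide_eq)
  qed
  also have "\<dots> = ?c / d_min * (real N * \<alpha> + 1 / \<alpha>)"
    by (simp add: add_divide_distrib distrib_left algebra_simps)
  finally show ?thesis .
qed

end

section \<open>The averaged iterate\<close>

lemma infnorm_sum_le: "infnorm (\<Sum>k\<in>K. f k) \<le> (\<Sum>k\<in>K. infnorm (f k))"
proof (induction K rule: infinite_finite_induct)
  case (insert k K)
  then show ?case
    using infnorm_triangle[of "f k" "sum f K"] by simp
qed (simp_all add: infnorm_0)

lemma infnorm_square_le_sum:
  fixes x :: "real ^ 'n"
  shows "(infnorm x)\<^sup>2 \<le> (\<Sum>i\<in>UNIV. (x $ i)\<^sup>2)"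
proof -
  have "(infnorm x)\<^sup>2 \<le> (norm x)\<^sup>2"
    by (intro power_mono infnorm_le_norm infnorm_pos_le)
  then show ?thesis
    by (simp add: norm_vec_def L2_set_def sum_nonneg)
qed

text \<open>
  Linearises Jensen's inequality for the square root: if the mean of \<open>a\<^sup>2\<close> is at most \<open>t\<^sup>2\<close>, then the
  mean of \<open>a\<close> is at most \<open>t\<close>.
\<close>

lemma le_weighted_square:
  fixes a t :: real
  assumes "0 < t"
  shows "a \<le> (t + a\<^sup>2 / t) / 2"
proof -
  have "0 \<le> (t - a)\<^sup>2 / t" using assms by simp
  also have "\<dots> = t + a\<^sup>2 / t - 2 * a"
    using assms by (simp add: power2_eq_square field_simps)
  finally show ?thesis by simp
qed

context async_q_learning
begin

lemma average_error_le_noise: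
  assumes "1 \<le> N"
  shows "infnorm (q_average r \<gamma> \<alpha> Q0 X N \<omega> - Q_opt)
    \<le> (1 + \<gamma> * d_max / (d_min * (1 - \<gamma>))) * ((\<Sum>k<N. infnorm (noise k \<omega>)) / real N)"
proof -
  have "q_average r \<gamma> \<alpha> Q0 X N \<omega> - Q_opt = (1 / real N) *\<^sub>R (\<Sum>k<N. noise k \<omega> + drift k \<omega>)"
    using assms by (simp add: vec_eq_iff q_average_def drift_def sum_subtractf right_diff_distrib
        sum_constant_scaleR del: sum_constant)
  then have "infnorm (q_average r \<gamma> \<alpha> Q0 X N \<omega> - Q_opt) \<le> (\<Sum>k<N. infnorm (noise k \<omega> + drift k \<omega>)) / real N"
    using infnorm_sum_le[of "\<lambda>k. noise k \<omega> + drift k \<omega>" "{..<N}"]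
    by (simp add: infnorm_mul divide_right_mono)
  also have "\<dots> \<le> ((\<Sum>k<N. infnorm (noise k \<omega>)) + (\<Sum>k<N. infnorm (drift k \<omega>))) / real N"
    unfolding sum.distrib[symmetric] by (intro divide_right_mono sum_mono infnorm_triangle) simp
  also have "\<dots> \<le> ((\<Sum>k<N. infnorm (noise k \<omega>))
      + \<gamma> * d_max / (d_min * (1 - \<gamma>)) * (\<Sum>k<N. infnorm (noise k \<omega>))) / real N"
    by (intro divide_right_mono add_left_mono sum_drift_le_sum_noise) simp
  finally show ?thesis
    by (simp add: distrib_right)
qed

text \<open>
  The bound before simplification of the constants. The number of pairs enters because the
  maximum norm of the noise is estimated by its Euclidean norm, coordinate by coordinate.
\<close>

theorem expected_average_error:
  assumes "1 \<le> N"
  shows "expectation (\<lambda>\<omega>. infnorm (q_average r \<gamma> \<alpha> Q0 X N \<omega> - Q_opt))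
    \<le> (1 + \<gamma> * d_max / (d_min * (1 - \<gamma>)))
      * sqrt (real CARD('s \<times> 'a) * ((2 / (1 - \<gamma>))\<^sup>2 / d_min * (\<alpha> + 1 / (real N * \<alpha>))))"
proof -
  define V where "V = real CARD('s \<times> 'a) * ((2 / (1 - \<gamma>))\<^sup>2 / d_min * (\<alpha> + 1 / (real N * \<alpha>)))"
  \<comment> \<open>The weight for which \<open>le_weighted_square\<close> is sharp when the average second moment is \<open>V\<close>.\<close>
  define t where "t = sqrt V"
  define \<kappa> where "\<kappa> = 1 + \<gamma> * d_max / (d_min * (1 - \<gamma>))"
  let ?S = "\<lambda>\<omega>. \<Sum>k<N. \<Sum>i\<in>UNIV. (noise k \<omega> $ i)\<^sup>2"
  have "0 < V"
    unfolding V_def using \<alpha> \<gamma> d_min(1) assms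
    by (intro mult_pos_pos divide_pos_pos add_pos_pos) (simp_all add: zero_less_power)
  then have t: "0 < t" "V / t = t"
    by (simp_all add: t_def real_div_sqrt)
  have "0 < d_max"
    using d_pos d_max less_le_trans by blast
  then have \<kappa>: "0 \<le> \<kappa>"
    unfolding \<kappa>_def using \<gamma> d_min(1) by (intro add_nonneg_nonneg divide_nonneg_nonneg mult_nonneg_nonneg) simp_all
  have pointwise: "infnorm (q_average r \<gamma> \<alpha> Q0 X N \<omega> - Q_opt) \<le> \<kappa> * ((t + ?S \<omega> / real N / t) / 2)" for \<omega>
  proof -
    have "infnorm (noise k \<omega>) \<le> (t + (\<Sum>i\<in>UNIV. (noise k \<omega> $ i)\<^sup>2) / t) / 2" for k
      using le_weighted_square[OF t(1), of "infnorm (noise k \<omega>)"]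
        divide_right_mono[OF infnorm_square_le_sum[of "noise k \<omega>"], of t] t(1) by simp
    then have "(\<Sum>k<N. infnorm (noise k \<omega>)) \<le> (\<Sum>k<N. (t + (\<Sum>i\<in>UNIV. (noise k \<omega> $ i)\<^sup>2) / t) / 2)"
      by (rule sum_mono)
    also have "\<dots> = (real N * t + ?S \<omega> / t) / 2"
      by (simp add: sum_divide_distrib[symmetric] sum.distrib)
    finally have "(\<Sum>k<N. infnorm (noise k \<omega>)) / real N \<le> (real N * t + ?S \<omega> / t) / 2 / real N"
      by (rule divide_right_mono) simp
    also have "\<dots> = (t + ?S \<omega> / real N / t) / 2"
      using assms t(1) by (simp add: field_simps)
    finally show ?thesis
      using average_error_le_noise[OF assms, of \<omega>] mult_left_mono[OF _ \<kappa>] order_trans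
      unfolding \<kappa>_def by blast
  qed
  have int: "integrable M ?S"
    by (intro Bochner_Integration.integrable_sum noise_integrable)
  have "expectation ?S = (\<Sum>k<N. \<Sum>i\<in>UNIV. expectation (\<lambda>\<omega>. (noise k \<omega> $ i)\<^sup>2))"
    by (subst Bochner_Integration.integral_sum)
       (auto intro!: Bochner_Integration.integrable_sum noise_integrable Bochner_Integration.integral_sum sum.cong)
  also have "\<dots> = (\<Sum>i\<in>UNIV. \<Sum>k<N. expectation (\<lambda>\<omega>. (noise k \<omega> $ i)\<^sup>2))"
    by (rule sum.swap)
  also have "\<dots> \<le> (\<Sum>i\<in>(UNIV :: ('s \<times> 'a) set). (2 / (1 - \<gamma>))\<^sup>2 / d_min * (real N * \<alpha> + 1 / \<alpha>))"
    by (rule sum_mono) (rule sum_noise_second_moment)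
  also have "\<dots> = real N * V"
    using assms \<alpha> by (simp add: V_def distrib_left mult_ac)
  finally have V: "expectation ?S / real N / t \<le> V / t"
    using assms t(1) by (intro divide_right_mono) (simp_all add: pos_divide_le_eq mult.commute)
  have "expectation (\<lambda>\<omega>. infnorm (q_average r \<gamma> \<alpha> Q0 X N \<omega> - Q_opt))
      \<le> expectation (\<lambda>\<omega>. \<kappa> * ((t + ?S \<omega> / real N / t) / 2))"
  proof (rule integral_mono')
    show "integrable M (\<lambda>\<omega>. \<kappa> * ((t + ?S \<omega> / real N / t) / 2))"
      using int by simp
    show "0 \<le> \<kappa> * ((t + ?S \<omega> / real N / t) / 2)" for \<omega>
      using \<kappa> t(1) by (intro mult_nonneg_nonneg divide_nonneg_nonneg add_nonneg_nonneg sum_nonneg) simp_all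
  qed (rule pointwise)
  also have "\<dots> = \<kappa> * ((t + expectation ?S / real N / t) / 2)"
    using int by (simp add: prob_space)
  also have "\<dots> \<le> \<kappa> * ((t + V / t) / 2)"
    by (rule mult_left_mono[OF divide_right_mono[OF add_left_mono[OF V]] \<kappa>]) simp
  also have "\<dots> = \<kappa> * sqrt V"
    unfolding t(2) by (simp add: t_def)
  finally show ?thesis
    unfolding \<kappa>_def V_def .
qed

end

text \<open>
  Compares the bound obtained with the stated one, for \<open>g = 1 - \<gamma>\<close>. Besides \<open>n \<le> n\<^sup>2\<close> and \<open>g \<le> 1\<close>, it
  uses \<open>4 \<alpha> \<le> 32 \<alpha>\<close> and \<open>\<gamma> D \<le> 4 \<gamma> D\<close>.
\<close>

lemma rate_constant_le:
  fixes n d D g \<gamma> \<alpha> :: real and N :: nat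
  assumes "1 \<le> n" "0 < d" "0 \<le> D" "0 < g" "g \<le> 1" "0 \<le> \<gamma>" "0 < \<alpha>" "1 \<le> N"
  shows "(1 + \<gamma> * D / (d * g)) * sqrt (n * ((2 / g)\<^sup>2 / d * (\<alpha> + 1 / (real N * \<alpha>))))
    \<le> (4 * \<gamma> * D + d * g) / (d powr (3 / 2) * g powr (5 / 2)) * n * sqrt (32 * \<alpha> + 1 / real N * (4 / \<alpha>))"
proof -
  define A where "A = 32 * \<alpha> + 1 / real N * (4 / \<alpha>)"
  have "n * ((2 / g)\<^sup>2 / d * (\<alpha> + 1 / (real N * \<alpha>))) = n * (4 * (\<alpha> + 1 / (real N * \<alpha>))) / (d * g\<^sup>2)"
    by (simp add: power_divide)
  also have "\<dots> \<le> n\<^sup>2 * A / (d * (g\<^sup>2 * g))"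
  proof (rule frac_le)
    have "4 * (\<alpha> + 1 / (real N * \<alpha>)) \<le> A"
      using assms by (simp add: A_def)
    then show "n * (4 * (\<alpha> + 1 / (real N * \<alpha>))) \<le> n\<^sup>2 * A"
      using assms by (intro mult_mono) (simp_all add: power2_eq_square)
    show "d * (g\<^sup>2 * g) \<le> d * g\<^sup>2"
      using assms by (simp add: mult_left_le)
  qed (use assms in \<open>simp_all add: A_def\<close>)
  finally have "sqrt (n * ((2 / g)\<^sup>2 / d * (\<alpha> + 1 / (real N * \<alpha>)))) \<le> sqrt (n\<^sup>2 * A / (d * (g\<^sup>2 * g)))"
    by simp
  also have "\<dots> = n * sqrt A / (sqrt d * (g * sqrt g))"
    using assms by (simp add: real_sqrt_mult real_sqrt_divide)
  finally have root: "sqrt (n * ((2 / g)\<^sup>2 / d * (\<alpha> + 1 / (real N * \<alpha>)))) \<le> n * sqrt A / (sqrt d * (g * sqrt g))" .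
  have "1 + \<gamma> * D / (d * g) = (\<gamma> * D + d * g) / (d * g)"
    using assms by (simp add: add_divide_distrib)
  also have "\<dots> \<le> (4 * \<gamma> * D + d * g) / (d * g)"
    using assms by (intro divide_right_mono) simp_all
  finally have "(1 + \<gamma> * D / (d * g)) * sqrt (n * ((2 / g)\<^sup>2 / d * (\<alpha> + 1 / (real N * \<alpha>))))
      \<le> (4 * \<gamma> * D + d * g) / (d * g) * (n * sqrt A / (sqrt d * (g * sqrt g)))"
    using root assms by (intro mult_mono) simp_all
  also have "\<dots> = (4 * \<gamma> * D + d * g) / ((d * sqrt d) * (g * g * sqrt g)) * n * sqrt A"
    by (simp add: mult_ac)
  also have "d * sqrt d = d powr (3 / 2)"
    using assms powr_add[of d 1 "1 / 2"] by (simp add: powr_half_sqrt)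
  also have "g * g * sqrt g = g powr (5 / 2)"
    using assms powr_add[of g 2 "1 / 2"] by (simp add: powr_half_sqrt powr_numeral power2_eq_square)
  finally show ?thesis
    unfolding A_def .
qed

theorem theorem2:
  fixes P :: "'s::finite \<Rightarrow> 'a::finite \<Rightarrow> 's pmf"
    and r :: "'s \<Rightarrow> 'a \<Rightarrow> 's \<Rightarrow> real"
    and \<gamma> \<alpha> d_max d_min :: real
    and \<pi>_opt :: "'s \<Rightarrow> 'a"
    and p :: "'s pmf"
    and \<beta> :: "'s \<Rightarrow> 'a pmf"
    and M :: "'w measure"
    and Q0 :: "'w \<Rightarrow> real ^ ('s \<times> 'a)"
    and X :: "nat \<Rightarrow> 'w \<Rightarrow> 's \<times> 'a \<times> 's"
    and N :: nat
  assumes "0 \<le> \<gamma>" and "\<gamma> < 1"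
    and "ergodic_mdp P"
    and "optimal_policy P r \<gamma> \<pi>_opt"
    and "prob_space M"
    and "Q0 \<in> borel_measurable M"
    and "iid_sampling M P p \<beta> Q0 X"
    and "\<And>s a. 0 < sa_dist p \<beta> (s, a)"
    and "0 < \<alpha>" and "\<alpha> < 1"
    and "\<And>s a s'. \<bar>r s a s'\<bar> \<le> 1"
    and "AE \<omega> in M. infnorm (Q0 \<omega>) \<le> 1"
    and "d_max = (MAX i. sa_dist p \<beta> i)"
    and "d_min = (MIN i. sa_dist p \<beta> i)"
    and "1 \<le> N"
  shows "(\<integral>\<omega>. infnorm (q_average r \<gamma> \<alpha> Q0 X N \<omega> - q_function P r \<gamma> \<pi>_opt) \<partial>M)
    \<le> (4 * \<gamma> * d_max + d_min * (1 - \<gamma>)) / (d_min powr (3 / 2) * (1 - \<gamma>) powr (5 / 2))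
        * real CARD('s) * real CARD('a) * sqrt (32 * \<alpha> + 1 / real N * (4 / \<alpha>))"
proof -
  have d_min_pos: "0 < d_min"
    unfolding assms(14) by (subst Min_gr_iff) (auto simp: assms(8))
  have d_min_le: "d_min \<le> sa_dist p \<beta> i" and d_max_ge: "sa_dist p \<beta> i \<le> d_max" for i
    unfolding assms(13,14) by (auto intro: Min_le Max_ge)
  interpret async_q_learning M P r \<gamma> \<alpha> d_max d_min p \<beta> Q0 X "q_function P r \<gamma> \<pi>_opt"
  proof (intro async_q_learning.intro async_q_learning_axioms.intro)
    show "bellman P r \<gamma> (q_function P r \<gamma> \<pi>_opt) i = q_function P r \<gamma> \<pi>_opt $ i" for i
      using optimal_q_function_Bellman[OF assms(1,2,11,4), of "fst i" "snd i"] by (simp add: bellman_def)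
  qed (fact assms d_min_pos d_min_le d_max_ge)+
  have "1 \<le> real CARD('s \<times> 'a)"
    using zero_less_card_finite[where 'a = "'s \<times> 'a"] by linarith
  moreover have "0 \<le> d_max"
    using d_min_pos d_min_le d_max_ge by (meson order_trans less_imp_le)
  ultimately show ?thesis
    using expected_average_error[OF assms(15)]
      rate_constant_le[of "real CARD('s \<times> 'a)" d_min d_max "1 - \<gamma>" \<gamma> \<alpha> N] assms(1,2,9,15) d_min_pos
    by (simp add: card_prod mult.assoc)
qed

end
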